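(* Let $K$ be a complex Krein space and let $\{f_k\}_{k=1}^\infty$ be a frame for $K$ with pre-frame operators $T^+$ and $T^-$. Then for every $\epsilon\in(0,1)$ there exist three $J$-orthonormal bases $\{e_k^1\}_{k=1}^\infty$, $\{e_k^2\}_{k=1}^\infty$ and $\{e_k^3\}_{k=1}^\infty$ for $K$ such that $$f_k^++f_m^-=\frac{1}{1-\epsilon}\Big\{\|T^+\|_J\big({e_k^+}^1+{e_k^+}^2+{e_k^+}^3\big)+\|T^-\|_J\big({e_m^-}^1+{e_m^-}^2+{e_m^-}^3\big)\Big\}\qquad\forall\,k,m\in\mathbb{N}.$$
   Context: Let $K$ be a Krein space with indefinite inner product $\langle\cdot,\cdot\rangle$ and a fixed countable $J$-orthonormal basis $\{e_j\}$ (so $\langle e_i,e_j\rangle=\pm\delta_{ij}$). Let $K^+$ be the closed span of the $e_i$ with $\langle e_i,e_i\rangle=1$ and $K^-$ the closed span of the $e_i$ with $\langle e_i,e_i\rangle=-1$. Then $K=K^+\dot{+}K^-$ is a fundamental decomposition: $(K^+,\langle\cdot,\cdot\rangle)$ is a Hilbert space and $(K^-,\langle\cdot,\cdot\rangle')$, with $\langle x,y\rangle'=-\langle x,y\rangle$, is a Hilbert space. $J$ is the corresponding fundamental symmetry, and $\|x\|_J^2=\langle x^+,x^+\rangle-\langle x^-,x^-\rangle$, where $x=x^++x^-$ with $x^\pm\in K^\pm$. A sequence $\{f_n\}$ in $K$ is a frame for $K$ if there are real numbers $B_2\le A_2<0<A_1\le B_1$ with $A_1\langle x^+,x^+\rangle\le\sum_n|\langle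 x^+,f_n^+\rangle|^2\le B_1\langle x^+,x^+\rangle$ for all $x^+\in K^+$ and $A_2\langle x^-,x^-\rangle\le\sum_n|\langle x^-,f_n^-\rangle|^2\le B_2\langle x^-,x^-\rangle$ for all $x^-\in K^-$. The pre-frame operators are $T^\pm:\ell^2(\mathbb{N})\to K^\pm$, $T^\pm\{c_k\}=\sum_k c_kf_k^\pm$, and $\|T^\pm\|_J$ is the operator norm with respect to $\|\cdot\|_J$ on $K^\pm$. For a $J$-orthonormal basis $\{e_k^i\}$ ($i=1,2,3$), the vectors ${e_k^+}^i$ are its members $e$ with $\langle e,e\rangle=1$ and the vectors ${e_m^-}^i$ are its members $e$ with $\langle e,e\rangle=-1$.
   Formalization: It is additionally assumed that the fixed J-orthonormal basis has infinitely many members with <e,e>=1 and infinitely many with <e,e>=-1; otherwise the vectors e_k^+ or e_m^- in the formula do not exist for all k, m. *)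

theory Defs
  imports "HOL-Analysis.Analysis" "HOL-Library.Infinite_Set"
begin

locale indefinite_inner_product_space = vector_space scale
  for scale :: "complex \<Rightarrow> 'a::ab_group_add \<Rightarrow> 'a" +
  fixes ip :: "'a \<Rightarrow> 'a \<Rightarrow> complex"
  assumes ip_add_left: "ip (x + y) z = ip x z + ip y z"
    and ip_scale_left: "ip (scale a x) y = a * ip x y"
    and ip_commute: "ip x y = cnj (ip y x)"
begin

text \<open>The form \<open>g\<close> is meant to be \<open>ip\<close> or its negative, so it is Hermitian,
  and \<open>g x x\<close> is real.\<close>

definition hilbert_subspace :: "('a \<Rightarrow> 'a \<Rightarrow> complex) \<Rightarrow> 'a set \<Rightarrow> bool" where
  "hilbert_subspace g S \<longleftrightarrow>
     subspace S \<and>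
     (\<forall>x\<in>S. x \<noteq> 0 \<longrightarrow> 0 < Re (g x x)) \<and>
     (\<forall>s :: nat \<Rightarrow> 'a. (\<forall>n. s n \<in> S) \<and>
          (\<forall>d>0. \<exists>M. \<forall>m\<ge>M. \<forall>n\<ge>M. sqrt (Re (g (s m - s n) (s m - s n))) < d)
        \<longrightarrow> (\<exists>x\<in>S. (\<lambda>n. sqrt (Re (g (s n - x) (s n - x)))) \<longlonglongrightarrow> 0))"

definition fundamental_decomposition :: "'a set \<Rightarrow> 'a set \<Rightarrow> bool" where
  "fundamental_decomposition P N \<longleftrightarrow>
     hilbert_subspace ip P \<and>
     hilbert_subspace (\<lambda>x y. - ip x y) N \<and>
     (\<forall>x\<in>P. \<forall>y\<in>N. ip x y = 0) \<and>
     (\<forall>x. \<exists>!p. p \<in> P \<and> x - p \<in> N)"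

end

text \<open>A Krein space with a chosen fundamental decomposition. The choice determines the norm
  \<open>jnorm\<close>, but not the topology: the norms of any two fundamental decompositions are equivalent.\<close>

locale krein_space = indefinite_inner_product_space scale ip
  for scale :: "complex \<Rightarrow> 'a::ab_group_add \<Rightarrow> 'a" and ip :: "'a \<Rightarrow> 'a \<Rightarrow> complex" +
  fixes Kp Km :: "'a set"
  assumes decomposition: "fundamental_decomposition Kp Km"
begin

definition pos_part :: "'a \<Rightarrow> 'a" where
  "pos_part x = (THE p. p \<in> Kp \<and> x - p \<in> Km)"

definition neg_part :: "'a \<Rightarrow> 'a" where
  "neg_part x = x - pos_part x"

definition jnorm :: "'a \<Rightarrow> real" where
  "jnorm x = sqrt (Re (ip (pos_part x) (pos_part x)) - Re (ip (neg_part x) (neg_part x)))"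

definition jconverges :: "(nat \<Rightarrow> 'a) \<Rightarrow> 'a \<Rightarrow> bool" where
  "jconverges s x \<longleftrightarrow> (\<lambda>n. jnorm (s n - x)) \<longlonglongrightarrow> 0"

definition closed_span :: "'a set \<Rightarrow> 'a set" where
  "closed_span S = {x. \<exists>s. (\<forall>n. s n \<in> span S) \<and> jconverges s x}"

definition pos_indices :: "(nat \<Rightarrow> 'a) \<Rightarrow> nat set" where
  "pos_indices e = {j. ip (e j) (e j) = 1}"

definition neg_indices :: "(nat \<Rightarrow> 'a) \<Rightarrow> nat set" where
  "neg_indices e = {j. ip (e j) (e j) = -1}"

definition K_plus :: "(nat \<Rightarrow> 'a) \<Rightarrow> 'a set" where
  "K_plus e = closed_span (e ` pos_indices e)"

definition K_minus :: "(nat \<Rightarrow> 'a) \<Rightarrow> 'a set" where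
  "K_minus e = closed_span (e ` neg_indices e)"

definition J_orthonormal :: "(nat \<Rightarrow> 'a) \<Rightarrow> bool" where
  "J_orthonormal e \<longleftrightarrow>
     (\<forall>i j. i \<noteq> j \<longrightarrow> ip (e i) (e j) = 0) \<and> (\<forall>i. ip (e i) (e i) = 1 \<or> ip (e i) (e i) = -1)"

text \<open>The last conjunct is not automatic for conditional bases; it is what makes the closed spans
  of the positive and of the negative members decompose the space.\<close>

definition J_orthonormal_basis :: "(nat \<Rightarrow> 'a) \<Rightarrow> bool" where
  "J_orthonormal_basis e \<longleftrightarrow>
     J_orthonormal e \<and>
     (\<forall>x. \<exists>!c. jconverges (\<lambda>n. \<Sum>j<n. scale (c j) (e j)) x) \<and>
     fundamental_decomposition (K_plus e) (K_minus e)"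

text \<open>The positive (negative) members of a sequence, listed in order of increasing index; meaningful
  only if there are infinitely many of them.\<close>

definition pos_member :: "(nat \<Rightarrow> 'a) \<Rightarrow> nat \<Rightarrow> 'a" where
  "pos_member e k = e (enumerate (pos_indices e) k)"

definition neg_member :: "(nat \<Rightarrow> 'a) \<Rightarrow> nat \<Rightarrow> 'a" where
  "neg_member e k = e (enumerate (neg_indices e) k)"

definition frame :: "(nat \<Rightarrow> 'a) \<Rightarrow> bool" where
  "frame f \<longleftrightarrow>
     (\<exists>A1 B1 A2 B2 :: real. B2 \<le> A2 \<and> A2 < 0 \<and> 0 < A1 \<and> A1 \<le> B1 \<and>
       (\<forall>x\<in>Kp. summable (\<lambda>n. (cmod (ip x (pos_part (f n))))\<^sup>2) \<and>
          A1 * Re (ip x x) \<le> (\<Sum>n. (cmod (ip x (pos_part (f n))))\<^sup>2) \<and>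
          (\<Sum>n. (cmod (ip x (pos_part (f n))))\<^sup>2) \<le> B1 * Re (ip x x)) \<and>
       (\<forall>x\<in>Km. summable (\<lambda>n. (cmod (ip x (neg_part (f n))))\<^sup>2) \<and>
          A2 * Re (ip x x) \<le> (\<Sum>n. (cmod (ip x (neg_part (f n))))\<^sup>2) \<and>
          (\<Sum>n. (cmod (ip x (neg_part (f n))))\<^sup>2) \<le> B2 * Re (ip x x)))"

definition ell2 :: "(nat \<Rightarrow> complex) set" where
  "ell2 = {c. summable (\<lambda>k. (cmod (c k))\<^sup>2)}"

definition ell2_norm :: "(nat \<Rightarrow> complex) \<Rightarrow> real" where
  "ell2_norm c = sqrt (\<Sum>k. (cmod (c k))\<^sup>2)"

definition T_plus :: "(nat \<Rightarrow> 'a) \<Rightarrow> (nat \<Rightarrow> complex) \<Rightarrow> 'a" where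
  "T_plus f c = (THE y. jconverges (\<lambda>n. \<Sum>k<n. scale (c k) (pos_part (f k))) y)"

definition T_minus :: "(nat \<Rightarrow> 'a) \<Rightarrow> (nat \<Rightarrow> complex) \<Rightarrow> 'a" where
  "T_minus f c = (THE y. jconverges (\<lambda>n. \<Sum>k<n. scale (c k) (neg_part (f k))) y)"

definition operator_jnorm :: "((nat \<Rightarrow> complex) \<Rightarrow> 'a) \<Rightarrow> real" where
  "operator_jnorm T = (SUP c \<in> {c \<in> ell2. ell2_norm c \<le> 1}. jnorm (T c))"

end

locale krein_space_with_basis = krein_space scale ip Kp Km
  for scale :: "complex \<Rightarrow> 'a::ab_group_add \<Rightarrow> 'a" and ip :: "'a \<Rightarrow> 'a \<Rightarrow> complex"
    and Kp Km :: "'a set" +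
  fixes e :: "nat \<Rightarrow> 'a"
  assumes basis: "J_orthonormal_basis e"
    and Kp_eq: "Kp = K_plus e"
    and Km_eq: "Km = K_minus e"

end

(* Following Casazza: on a Hilbert space an operator A with |A| < 1 satisfies 1 + A = V + W with V and W
   unitary, so A is a sum of the three unitaries V, W and -1. The members of a Bessel sequence are the
   images of the standard basis under its synthesis operator T, to which this is applied after
   rescaling by (1 - epsilon) / |T|. All operators are made to act on one copy of l^2, the coordinate
   space of K for the given basis, carrying the norm of K; the rescaled T+ and T- are the diagonal
   blocks of a single A there. The unitaries commute with multiplication by i and with the projection
   onto the positive coordinates, so they carry the given basis to J-orthonormal bases with the same
   signs at the same indices, for which the fundamental decomposition is unchanged. *)
theory Submission
  imports Defs
begin

text \<open>The factor \<open>1 - \<epsilon>\<close> buys strictness twice. With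
  \<open>norm A < 1\<close> the operator \<open>R = 1 + A\<close> is invertible, and it has norm
  below 2, so \<open>(R' R)\<^sup>-\<^sup>1 - 1/4\<close> (with \<open>R'\<close> the adjoint) is
  bounded below by a positive constant and has a self-adjoint square root \<open>B\<close>. Then
  \<open>(1/2 + i B) (1/2 - i B) = (R' R)\<^sup>-\<^sup>1\<close>, which is what makes
  \<open>R (1/2 \<plusminus> i B)\<close> unitary, while the two add up to \<open>R\<close>. The
  obstacle is that the unitaries have to respect complex scalars and the splitting of
  \<open>K\<close>, not only the norm. Operators are treated as real-linear, with multiplication by
  \<open>i\<close> as one given operator, so both demands become commutation relations. A single
  property delivers them: the square root commutes with everything that commutes with the operator
  under the root. It is therefore carried along from the construction of the root to the final
  unitaries.\<close>

section \<open>Adjoints and square roots of operators on a real Hilbert space\<close>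

text \<open>The representing vector is the minimiser \<open>y\<close> of
  \<open>\<phi> x = |x|\<^sup>2 - 2 f x\<close>: completeness provides it, and the vanishing of the
  first variation at \<open>y\<close> reads \<open>f x = inner x y\<close>.\<close>

lemma riesz_representation:
  fixes f :: "'a::{real_inner,banach} \<Rightarrow> real"
  assumes "bounded_linear f"
  obtains y where "\<And>x. f x = inner x y"
proof -
  interpret f: bounded_linear f by fact
  obtain M where M: "\<And>x. norm (f x) \<le> norm x * M" and "M > 0"
    using f.pos_bounded by blast
  define \<phi> where "\<phi> x = (norm x)\<^sup>2 - 2 * f x" for x
  have lower: "\<phi> x \<ge> - M\<^sup>2" for x
  proof -
    have "f x \<le> norm x * M" using M[of x] by simp
    moreover have "0 \<le> (norm x - M)\<^sup>2" by simp
    ultimately show ?thesis unfolding \<phi>_def power2_diff by simp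
  qed
  define m where "m = Inf (range \<phi>)"
  have bdd: "bdd_below (range \<phi>)" using lower by (auto simp: bdd_below_def)
  have m_le: "m \<le> \<phi> x" for x unfolding m_def by (rule cINF_lower[OF bdd]) simp
  have "\<exists>x. \<phi> x < m + 1 / real (Suc n)" for n
  proof -
    have "Inf (range \<phi>) < m + 1 / real (Suc n)" by (simp add: m_def)
    then show ?thesis using cInf_less_iff[OF _ bdd] by auto
  qed
  then obtain X where X: "\<And>n. \<phi> (X n) < m + 1 / real (Suc n)" by metis
  \<comment> \<open>Besides the squared norm \<open>\<phi>\<close> has only a linear term, which
    cancels here; so two nearly minimal points are close to each other.\<close>
  have parallelogram: "(norm (x - y))\<^sup>2 = 2 * \<phi> x + 2 * \<phi> y - 4 * \<phi> ((1/2) *\<^sub>R (x + y))" for x y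
    unfolding \<phi>_def f.scaleR f.add
    by (simp add: power2_norm_eq_inner inner_diff inner_add inner_commute field_simps)
  have close: "(norm (X i - X j))\<^sup>2 \<le> 2 / real (Suc i) + 2 / real (Suc j)" for i j
    using parallelogram[of "X i" "X j"] X[of i] X[of j] m_le[of "(1/2) *\<^sub>R (X i + X j)"] by simp
  have "Cauchy X"
  proof (rule metric_CauchyI)
    fix e :: real assume "e > 0"
    then obtain N where N: "4 / e\<^sup>2 < real (Suc N)"
      by (metis reals_Archimedean2 less_Suc_eq of_nat_less_iff less_trans)
    show "\<exists>N. \<forall>i\<ge>N. \<forall>j\<ge>N. dist (X i) (X j) < e"
    proof (intro exI allI impI)
      fix i j assume ij: "i \<ge> N" "j \<ge> N"
      have *: "2 / real (Suc k) \<le> 2 / real (Suc N)" if "k \<ge> N" for k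
        using that by (intro divide_left_mono) auto
      have "(norm (X i - X j))\<^sup>2 \<le> 4 / real (Suc N)"
        using close[of i j] *[OF ij(1)] *[OF ij(2)] by simp
      also have "\<dots> < e\<^sup>2" using N \<open>e > 0\<close> by (simp add: field_simps)
      finally show "dist (X i) (X j) < e"
        using \<open>e > 0\<close> by (simp add: dist_norm power2_less_imp_less)
    qed
  qed
  then obtain y where y: "X \<longlonglongrightarrow> y" using Cauchy_convergent convergent_def by blast
  have "(\<lambda>n. \<phi> (X n)) \<longlonglongrightarrow> \<phi> y"
    unfolding \<phi>_def by (intro tendsto_intros f.tendsto y)
  moreover have "(\<lambda>n. m + 1 / real (Suc n)) \<longlonglongrightarrow> m + 0"
    by (intro tendsto_intros LIMSEQ_Suc[OF lim_1_over_n])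
  ultimately have "\<phi> y \<le> m + 0"
    by (rule LIMSEQ_le) (use X in \<open>auto intro: less_imp_le\<close>)
  then have min: "\<phi> y \<le> \<phi> x" for x using m_le[of x] by simp
  have "f x = inner x y" for x
  proof (rule ccontr)
    assume ne: "f x \<noteq> inner x y"
    define d where "d = f x - inner x y"
    \<comment> \<open>Moving from \<open>y\<close> by \<open>t *\<^sub>R x\<close> changes
      \<open>\<phi>\<close> by \<open>- t\<^sup>2 (2 + |x|\<^sup>2)\<close>, against minimality
      unless \<open>t = 0\<close>. The summand 1 keeps the denominator positive at
      \<open>x = 0\<close>.\<close>
    define t where "t = d / (1 + (norm x)\<^sup>2)"
    have pos: "1 + (norm x)\<^sup>2 > 0" by (simp add: add_pos_nonneg)
    have "\<phi> (y + t *\<^sub>R x) - \<phi> y = t\<^sup>2 * (norm x)\<^sup>2 - 2 * t * d"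
      unfolding \<phi>_def f.scaleR f.add d_def power2_norm_eq_inner power2_eq_square[of t]
      by (simp add: inner_add inner_commute algebra_simps)
    then have "2 * t * d \<le> t\<^sup>2 * (norm x)\<^sup>2" using min[of "y + t *\<^sub>R x"] by simp
    moreover have "d = t * (1 + (norm x)\<^sup>2)" using pos by (simp add: t_def)
    ultimately have "2 * t\<^sup>2 + t\<^sup>2 * (norm x)\<^sup>2 \<le> 0" by (simp add: power2_eq_square algebra_simps)
    moreover have "0 \<le> t\<^sup>2 * (norm x)\<^sup>2" "0 \<le> t\<^sup>2" by simp_all
    ultimately have "t\<^sup>2 = 0" by linarith
    then have "t = 0" by simp
    then show False using ne pos by (simp add: t_def d_def)
  qed
  then show thesis by (rule that)
qed

lemma blinfun_adjoint_exists:
  fixes A :: "'a::{real_inner,banach} \<Rightarrow>\<^sub>L 'b::real_inner"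
  obtains A' :: "'b \<Rightarrow>\<^sub>L 'a" where "\<And>x y. inner (A x) y = inner x (A' y)"
proof -
  have "\<exists>z. \<forall>x. inner (A x) y = inner x z" for y
  proof -
    have "bounded_linear (\<lambda>x. inner (A x) y)"
      by (rule bounded_linear_compose[OF bounded_linear_inner_left]) (rule blinfun.bounded_linear_right)
    then show ?thesis by (metis riesz_representation)
  qed
  then obtain g where g: "\<And>x y. inner (A x) y = inner x (g y)" by metis
  have "bounded_linear g"
  proof (rule bounded_linear_intro)
    show "g (x + y) = g x + g y" for x y
      by (rule vector_eq_ldot[THEN iffD1]) (simp add: inner_add_right flip: g)
    show "g (r *\<^sub>R x) = r *\<^sub>R g x" for r x
      by (rule vector_eq_ldot[THEN iffD1]) (simp flip: g)
    show "norm (g y) \<le> norm y * norm A" for y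
    proof -
      have "(norm (g y))\<^sup>2 = inner (A (g y)) y" by (simp add: power2_norm_eq_inner g)
      also have "\<dots> \<le> norm (A (g y)) * norm y" by (rule norm_cauchy_schwarz)
      also have "\<dots> \<le> norm A * norm (g y) * norm y" by (intro mult_right_mono norm_blinfun) simp
      finally show ?thesis
        by (cases "norm (g y) = 0") (auto simp: power2_eq_square mult_ac)
    qed
  qed
  then show thesis using g that[of "Blinfun g"] by (simp add: bounded_linear_Blinfun_apply)
qed

definition self_adjoint :: "('a::real_inner \<Rightarrow>\<^sub>L 'a) \<Rightarrow> bool" where
  "self_adjoint A \<longleftrightarrow> (\<forall>x y. inner (A x) y = inner x (A y))"

text \<open>The square root is \<open>c (1 - Y)\<close>, where \<open>c\<^sup>2 (1 - E) = D\<close> and \<open>Y\<close> is the fixed point of the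
  contraction \<open>Y \<mapsto> (E + Y\<^sup>2) / 2\<close>.\<close>

lemma self_adjoint_sqrt:
  fixes D :: "'a::{real_inner,banach} \<Rightarrow>\<^sub>L 'a"
  assumes D: "self_adjoint D" and "m > 0" and lower: "\<And>x. m * (norm x)\<^sup>2 \<le> inner (D x) x"
  obtains B where "self_adjoint B" "B o\<^sub>L B = D" "\<And>Z. Z o\<^sub>L D = D o\<^sub>L Z \<Longrightarrow> Z o\<^sub>L B = B o\<^sub>L Z"
proof -
  define k where "k = norm D + m"
  have "k > 0" using \<open>m > 0\<close> by (simp add: k_def add_nonneg_pos)
  \<comment> \<open>The bound \<open>1 - 2 t m + t\<^sup>2 k\<^sup>2\<close> for the squared norm of
    \<open>E\<close> is least at this \<open>t\<close>, with value \<open>q\<^sup>2\<close>; adding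
    \<open>m\<close> to \<open>norm D\<close> ensures \<open>m \<le> k\<close>.\<close>
  define t where "t = m / k\<^sup>2"
  have "t > 0" using \<open>m > 0\<close> \<open>k > 0\<close> by (simp add: t_def)
  define E where "E = id_blinfun - t *\<^sub>R D"
  define q where "q = sqrt (1 - m\<^sup>2 / k\<^sup>2)"
  have "m\<^sup>2 / k\<^sup>2 \<le> 1"
    using \<open>m > 0\<close> \<open>k > 0\<close> by (simp add: k_def divide_le_eq power_mono)
  have "q < 1" "0 \<le> q" using \<open>m > 0\<close> \<open>k > 0\<close> \<open>m\<^sup>2 / k\<^sup>2 \<le> 1\<close> by (auto simp: q_def)
  have q2: "q\<^sup>2 = 1 - m\<^sup>2 / k\<^sup>2" using \<open>m\<^sup>2 / k\<^sup>2 \<le> 1\<close> by (simp add: q_def)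
  have "norm E \<le> q"
  proof (rule norm_blinfun_bound[OF \<open>0 \<le> q\<close>])
    fix x
    have "norm (D x) \<le> k * norm x"
      using norm_blinfun[of D x] \<open>m > 0\<close> unfolding k_def
      by (smt (verit) mult_right_mono norm_ge_zero)
    then have "(norm (D x))\<^sup>2 \<le> k\<^sup>2 * (norm x)\<^sup>2"
      by (metis norm_ge_zero power_mono power_mult_distrib)
    then have 1: "t\<^sup>2 * (norm (D x))\<^sup>2 \<le> t\<^sup>2 * (k\<^sup>2 * (norm x)\<^sup>2)"
      by (intro mult_left_mono) auto
    have 2: "2 * t * (m * (norm x)\<^sup>2) \<le> 2 * t * inner (D x) x"
      using \<open>t > 0\<close> by (intro mult_left_mono lower) auto
    have "(norm (E x))\<^sup>2 = (norm x)\<^sup>2 - 2 * t * inner (D x) x + t\<^sup>2 * (norm (D x))\<^sup>2"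
      unfolding E_def power2_norm_eq_inner
      by (simp add: blinfun.bilinear_simps inner_diff inner_commute power2_eq_square algebra_simps)
    also have "\<dots> \<le> (norm x)\<^sup>2 - 2 * t * (m * (norm x)\<^sup>2) + t\<^sup>2 * (k\<^sup>2 * (norm x)\<^sup>2)"
      using 1 2 by linarith
    also have "\<dots> = (q * norm x)\<^sup>2"
      using \<open>k > 0\<close> unfolding power_mult_distrib q2 t_def by (simp add: field_simps power2_eq_square)
    finally show "norm (E x) \<le> q * norm x" using \<open>0 \<le> q\<close> by (auto intro: power2_le_imp_le)
  qed
  \<comment> \<open>The smaller root of \<open>r\<^sup>2 - 2 r + q = 0\<close>: \<open>g\<close>
    then maps the ball of radius \<open>r\<close> into itself, and \<open>r < 1\<close> also serves
    as the contraction constant.\<close>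
  define r where "r = 1 - sqrt (1 - q)"
  have r: "0 \<le> r" "r < 1" and r2: "q + r\<^sup>2 = 2 * r"
    using \<open>q < 1\<close> \<open>0 \<le> q\<close> by (auto simp: r_def power2_diff)
  \<comment> \<open>Self-adjointness and the commutation property are closed conditions; put into
    the set, they are inherited by the fixed point.\<close>
  define S where "S = cball 0 r \<inter> {Y. self_adjoint Y} \<inter> {Y. \<forall>Z. Z o\<^sub>L D = D o\<^sub>L Z \<longrightarrow> Z o\<^sub>L Y = Y o\<^sub>L Z}"
  have S_iff: "Y \<in> S \<longleftrightarrow> norm Y \<le> r \<and> (\<forall>x y. inner (Y x) y = inner x (Y y)) \<and>
      (\<forall>Z. Z o\<^sub>L D = D o\<^sub>L Z \<longrightarrow> Z o\<^sub>L Y = Y o\<^sub>L Z)" for Y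
    by (simp only: S_def self_adjoint_def Int_iff mem_Collect_eq mem_cball_0 conj_assoc)
  define g where "g Y = (1/2) *\<^sub>R (E + (Y o\<^sub>L Y))" for Y
  have "closed S"
    unfolding S_def self_adjoint_def
    by (intro closed_Int closed_Collect_all closed_cball closed_Collect_imp closed_Collect_eq
        continuous_intros open_Collect_const)
  have "\<exists>!Y\<in>S. g Y = Y"
  proof (rule Banach_fix[OF _ _ r])
    show "complete S" using \<open>closed S\<close> by (simp add: complete_eq_closed)
    show "S \<noteq> {}" using r
      by (intro ex_in_conv[THEN iffD1] exI[of _ 0]) (simp add: S_def self_adjoint_def)
    show "g ` S \<subseteq> S"
    proof (clarify)
      fix Y assume "Y \<in> S"
      then have Y_norm: "norm Y \<le> r" and Y_adj: "inner (Y x) y = inner x (Y y)"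
        and Y_comm: "Z o\<^sub>L D = D o\<^sub>L Z \<Longrightarrow> Z o\<^sub>L Y = Y o\<^sub>L Z" for x y Z
        by (blast dest: S_iff[THEN iffD1])+
      have "norm (Y o\<^sub>L Y) \<le> r * r"
        by (rule order_trans[OF norm_blinfun_compose]) (use Y_norm r in \<open>auto intro!: mult_mono\<close>)
      then have "norm (g Y) \<le> (q + r\<^sup>2) / 2"
        using norm_triangle_ineq[of E "Y o\<^sub>L Y"] \<open>norm E \<le> q\<close> by (simp add: g_def power2_eq_square)
      then have "norm (g Y) \<le> r" using r2 by simp
      moreover have "inner (g Y x) y = inner x (g Y y)" for x y
        using D Y_adj
        by (simp add: self_adjoint_def g_def E_def blinfun.bilinear_simps inner_diff inner_add)
      moreover have "Z o\<^sub>L g Y = g Y o\<^sub>L Z" if "Z o\<^sub>L D = D o\<^sub>L Z" for Z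
      proof -
        have "Z (D x) = D (Z x)" for x using that by (metis blinfun_apply_blinfun_compose)
        moreover have "Z (Y x) = Y (Z x)" for x
          by (metis Y_comm[OF that] blinfun_apply_blinfun_compose)
        ultimately show ?thesis
          by (auto intro!: blinfun_eqI simp: g_def E_def blinfun.bilinear_simps)
      qed
      ultimately show "g Y \<in> S" by (blast intro: S_iff[THEN iffD2])
    qed
    show "dist (g x) (g y) \<le> r * dist x y" if xy: "x \<in> S" "y \<in> S" for x y
    proof -
      \<comment> \<open>A splitting of the difference of squares that does not assume that
        \<open>x\<close> and \<open>y\<close> commute.\<close>
      have "(x o\<^sub>L x) - (y o\<^sub>L y) = (x o\<^sub>L (x - y)) + ((x - y) o\<^sub>L y)"
        by (auto intro!: blinfun_eqI simp: blinfun.bilinear_simps)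
      also have "norm \<dots> \<le> r * norm (x - y) + norm (x - y) * r"
        by (intro norm_triangle_mono order_trans[OF norm_blinfun_compose] mult_right_mono mult_left_mono)
          (use xy in \<open>simp_all add: S_def\<close>)
      finally have "norm ((x o\<^sub>L x) - (y o\<^sub>L y)) \<le> 2 * (r * norm (x - y))" by simp
      moreover have "g x - g y = (1/2) *\<^sub>R ((x o\<^sub>L x) - (y o\<^sub>L y))"
        by (simp add: g_def algebra_simps)
      ultimately show "dist (g x) (g y) \<le> r * dist x y" by (simp add: dist_norm)
    qed
  qed
  then obtain Y where "Y \<in> S" and gY: "g Y = Y" by blast
  then have Y_adj: "inner (Y x) y = inner x (Y y)"
    and Y_comm: "Z o\<^sub>L D = D o\<^sub>L Z \<Longrightarrow> Z o\<^sub>L Y = Y o\<^sub>L Z" for x y Z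
    by (blast dest: S_iff[THEN iffD1])+
  \<comment> \<open>The fixed point equation gives \<open>(1 - Y)\<^sup>2 = 1 - E = t D\<close>, so
    this factor normalises the square to \<open>D\<close>.\<close>
  define c where "c = 1 / sqrt t"
  have c2: "c * c * t = 1" using \<open>t > 0\<close> by (simp add: c_def field_simps)
  define B where "B = c *\<^sub>R (id_blinfun - Y)"
  show thesis
  proof
    show "self_adjoint B"
      by (simp add: self_adjoint_def B_def blinfun.bilinear_simps inner_diff Y_adj)
    have "2 *\<^sub>R g Y = 2 *\<^sub>R Y" by (simp add: gY)
    then have YY: "Y o\<^sub>L Y = 2 *\<^sub>R Y - E" by (simp add: g_def algebra_simps)
    have "Y (Y x) = 2 *\<^sub>R Y x - x + t *\<^sub>R D x" for x
      using arg_cong[OF YY, of "\<lambda>F. blinfun_apply F x"] by (simp add: E_def blinfun.bilinear_simps)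
    then have "(x - Y x) - (Y x - Y (Y x)) = t *\<^sub>R D x" for x by (simp add: scaleR_2)
    moreover have "(B o\<^sub>L B) x = (c * c) *\<^sub>R ((x - Y x) - (Y x - Y (Y x)))" for x
      by (simp add: B_def blinfun.bilinear_simps algebra_simps)
    ultimately have "(B o\<^sub>L B) x = (c * c * t) *\<^sub>R D x" for x by simp
    then show "B o\<^sub>L B = D" by (intro blinfun_eqI) (simp add: c2)
    show "Z o\<^sub>L B = B o\<^sub>L Z" if "Z o\<^sub>L D = D o\<^sub>L Z" for Z
    proof -
      have "Z (Y x) = Y (Z x)" for x
        by (metis Y_comm[OF that] blinfun_apply_blinfun_compose)
      then show ?thesis by (auto intro!: blinfun_eqI simp: B_def blinfun.bilinear_simps)
    qed
  qed
qed

text \<open>A right inverse is the fixed point of the contraction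
  \<open>X \<mapsto> 1 - A X\<close>. It is a left inverse too, because the injective operator
  \<open>1 + A\<close> annihilates \<open>X (x + A x) - x\<close>.\<close>

lemma one_plus_contraction_inverse:
  fixes A :: "'a::banach \<Rightarrow>\<^sub>L 'a"
  assumes "norm A < 1"
  obtains X where "(id_blinfun + A) o\<^sub>L X = id_blinfun" "X o\<^sub>L (id_blinfun + A) = id_blinfun"
proof -
  have "\<exists>!X\<in>UNIV. id_blinfun - (A o\<^sub>L X) = X"
  proof (rule Banach_fix[OF _ _ norm_ge_zero assms])
    show "dist (id_blinfun - (A o\<^sub>L X)) (id_blinfun - (A o\<^sub>L Y)) \<le> norm A * dist X Y" for X Y
    proof -
      have "(id_blinfun - (A o\<^sub>L X)) - (id_blinfun - (A o\<^sub>L Y)) = A o\<^sub>L (Y - X)"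
        by (intro blinfun_eqI) (simp add: blinfun.bilinear_simps algebra_simps)
      then show ?thesis using norm_blinfun_compose[of A "Y - X"]
        by (simp add: dist_norm norm_minus_commute)
    qed
  qed (auto simp: complete_UNIV)
  then obtain X where X: "id_blinfun - (A o\<^sub>L X) = X" by blast
  have 1: "X x + A (X x) = x" for x
    using arg_cong[OF X, of "\<lambda>F. blinfun_apply F x"] by (simp add: blinfun.bilinear_simps algebra_simps)
  have inj: "x = 0" if "x + A x = 0" for x
  proof (rule ccontr)
    assume "x \<noteq> 0"
    have "norm x = norm (A x)" using that by (metis add_eq_0_iff norm_minus_cancel)
    also have "\<dots> \<le> norm A * norm x" by (rule norm_blinfun)
    also have "\<dots> < norm x" using assms \<open>x \<noteq> 0\<close> by simp
    finally show False by simp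
  qed
  have 2: "X (x + A x) = x" for x
    using inj[of "X (x + A x) - x"] 1[of "x + A x"] by (simp add: blinfun.bilinear_simps algebra_simps)
  show thesis
    by (rule that; rule blinfun_eqI) (use 1 2 in \<open>simp_all add: blinfun.bilinear_simps\<close>)
qed


text \<open>With \<open>R = 1 + A\<close> and \<open>B\<^sup>2 = (R\<^sup>* R)\<^sup>-\<^sup>1 - 1/4\<close>, the two unitaries are \<open>R (1/2 \<plusminus> i B)\<close>, where
  \<open>i\<close> is the complex structure \<open>I\<close>.\<close>

proposition one_plus_contraction_sum_unitaries:
  fixes A A' I :: "'a::{real_inner,banach} \<Rightarrow>\<^sub>L 'a"
  assumes norm: "norm A < 1" and adj: "\<And>x y. inner (A x) y = inner x (A' y)"
    and II: "\<And>x. I (I x) = - x" and I_adj: "\<And>x y. inner (I x) y = - inner x (I y)"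
    and IA: "\<And>x. I (A x) = A (I x)"
  obtains V W :: "'a \<Rightarrow>\<^sub>L 'a" where
    "\<And>x. norm (V x) = norm x" "surj V" "\<And>x. norm (W x) = norm x" "surj W"
    "\<And>x. V x + W x = x + A x"
    "\<And>Z. \<lbrakk>Z o\<^sub>L A = A o\<^sub>L Z; Z o\<^sub>L A' = A' o\<^sub>L Z; Z o\<^sub>L I = I o\<^sub>L Z\<rbrakk>
       \<Longrightarrow> Z o\<^sub>L V = V o\<^sub>L Z \<and> Z o\<^sub>L W = W o\<^sub>L Z"
proof -
  define R where "R = id_blinfun + A"
  define R' where "R' = id_blinfun + A'"
  have R_apply: "R x = x + A x" "R' x = x + A' x" for x
    by (simp_all add: R_def R'_def blinfun.bilinear_simps)
  have R_adj: "inner (R x) y = inner x (R' y)" for x y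
    by (simp add: R_apply inner_add adj)
  obtain X where X: "R o\<^sub>L X = id_blinfun" "X o\<^sub>L R = id_blinfun"
    using one_plus_contraction_inverse[OF norm] unfolding R_def .
  have RX: "R (X x) = x" "X (R x) = x" for x
    using X[THEN arg_cong, of "\<lambda>F. blinfun_apply F x"] by simp_all
  obtain X' :: "'a \<Rightarrow>\<^sub>L 'a" where X_adj: "\<And>x y. inner (X x) y = inner x (X' y)"
    using blinfun_adjoint_exists[of X] by blast
  have RX': "R' (X' x) = x" "X' (R' x) = x" for x
    by (rule vector_eq_ldot[THEN iffD1]; simp add: RX flip: R_adj X_adj)+
  have IA': "I (A' x) = A' (I x)" for x
  proof (rule vector_eq_ldot[THEN iffD1], rule allI)
    show "inner z (I (A' x)) = inner z (A' (I x))" for z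
      using I_adj[of z "A' x"] I_adj[of "A z" x] by (simp add: IA flip: adj)
  qed
  \<comment> \<open>As \<open>X\<close> and \<open>X'\<close> invert \<open>R\<close> and
    \<open>R'\<close>, the product \<open>X o\<^sub>L X'\<close> is
    \<open>(R' R)\<^sup>-\<^sup>1\<close>.\<close>
  define D where "D = (X o\<^sub>L X') - (1/4) *\<^sub>R id_blinfun"
  have D_apply: "D x = X (X' x) - (1/4) *\<^sub>R x" for x
    by (simp add: D_def blinfun.bilinear_simps)
  \<comment> \<open>From \<open>norm R \<le> a\<close> follows \<open>|X' x| \<ge> |x| / a\<close>,
    so \<open>D\<close> is at least \<open>1 / a\<^sup>2 - 1/4\<close>, which is positive because
    \<open>a < 2\<close>.\<close>
  define a where "a = 1 + norm A"
  have a: "1 \<le> a" "a < 2" using norm by (auto simp: a_def)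
  have R_bound: "norm (R x) \<le> a * norm x" for x
    using norm_triangle_ineq[of x "A x"] norm_blinfun[of A x] by (simp add: R_apply a_def algebra_simps)
  have X'_lower: "norm x \<le> a * norm (X' x)" for x
  proof -
    have "norm x * norm x = inner (R x) (X' x)"
      by (simp add: R_adj RX' flip: power2_norm_eq_inner power2_eq_square)
    also have "\<dots> \<le> norm (R x) * norm (X' x)" by (rule norm_cauchy_schwarz)
    also have "\<dots> \<le> a * norm x * norm (X' x)" by (intro mult_right_mono R_bound) simp
    finally show ?thesis by (cases "x = 0") (use a in \<open>auto simp: mult_ac\<close>)
  qed
  have D_lower: "(1 / a\<^sup>2 - 1 / 4) * (norm x)\<^sup>2 \<le> inner (D x) x" for x
  proof -
    have "(norm x)\<^sup>2 \<le> a\<^sup>2 * (norm (X' x))\<^sup>2"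
      using X'_lower[of x] by (metis norm_ge_zero power_mono power_mult_distrib)
    then have "(norm x)\<^sup>2 / a\<^sup>2 \<le> (norm (X' x))\<^sup>2"
      using a by (simp add: field_simps)
    then show ?thesis
      by (simp add: D_apply inner_diff X_adj algebra_simps flip: power2_norm_eq_inner)
  qed
  have "a\<^sup>2 < 2\<^sup>2" using a by (intro power_strict_mono) auto
  then have D_pos: "1 / a\<^sup>2 - 1 / 4 > 0" using a by (simp add: field_simps)
  have "inner (X (X' x)) y = inner x (X (X' y))" for x y by (metis X_adj inner_commute)
  then have D_self: "self_adjoint D" by (simp add: self_adjoint_def D_apply inner_diff)
  obtain B where B: "self_adjoint B" "B o\<^sub>L B = D"
      and B_comm: "\<And>Z. Z o\<^sub>L D = D o\<^sub>L Z \<Longrightarrow> Z o\<^sub>L B = B o\<^sub>L Z"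
    using self_adjoint_sqrt[OF D_self D_pos D_lower] by blast
  have BB: "B (B x) = D x" for x using B(2) by (metis blinfun_apply_blinfun_compose)
  have B_adj: "inner (B x) y = inner x (B y)" for x y using B(1) by (simp add: self_adjoint_def)
  \<comment> \<open>Commuting with \<open>R\<close> and \<open>R'\<close> passes to their inverses,
    hence to \<open>D\<close>, hence to \<open>B\<close>.\<close>
  have comm_B: "Z (B x) = B (Z x)"
    if "\<And>x. Z (R x) = R (Z x)" "\<And>x. Z (R' x) = R' (Z x)" for Z :: "'a \<Rightarrow>\<^sub>L 'a" and x
  proof -
    have "X (R (Z (X x))) = X (Z x)" "X' (R' (Z (X' x))) = X' (Z x)" for x
      by (simp_all add: RX RX' flip: that)
    then have "Z (X x) = X (Z x)" "Z (X' x) = X' (Z x)" for x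
      by (simp_all add: RX RX')
    then have "Z o\<^sub>L D = D o\<^sub>L Z"
      by (intro blinfun_eqI) (simp add: D_apply blinfun.bilinear_simps)
    from B_comm[OF this] show ?thesis by (metis blinfun_apply_blinfun_compose)
  qed
  have IB: "I (B x) = B (I x)" for x
    by (rule comm_B) (simp_all add: R_apply blinfun.bilinear_simps IA IA')
  have IR: "I (R x) = R (I x)" and IR': "I (R' x) = R' (I x)" for x
    by (simp_all add: R_apply blinfun.bilinear_simps IA IA')
  \<comment> \<open>\<open>comm_B\<close> is no help here, as \<open>R' R\<close> need not commute
    with \<open>R\<close> and \<open>R'\<close>; but it commutes with its own inverse, and so with
    \<open>D\<close>.\<close>
  have CB: "R' (R (B x)) = B (R' (R x))" for x
  proof -
    have "D (R' (R x)) = R' (R (D x))" for x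
      by (simp add: D_apply blinfun.bilinear_simps RX RX')
    then have "(R' o\<^sub>L R) o\<^sub>L D = D o\<^sub>L (R' o\<^sub>L R)" by (intro blinfun_eqI) simp
    from B_comm[OF this] show ?thesis by (metis blinfun_apply_blinfun_compose)
  qed
  \<comment> \<open>Only \<open>s\<^sup>2 = 1\<close> matters, which covers both signs. With
    \<open>U'\<close> the adjoint, \<open>U U' = 1\<close> gives surjectivity and
    \<open>U' U = 1\<close> gives the isometry.\<close>
  have key: "(\<forall>x. norm (U x) = norm x) \<and> surj U"
    if U: "\<And>x. U x = R ((1/2) *\<^sub>R x + s *\<^sub>R I (B x))" and s: "s * s = 1"
    for U :: "'a \<Rightarrow>\<^sub>L 'a" and s :: real
  proof -
    define U' where "U' y = (1/2) *\<^sub>R R' y - s *\<^sub>R I (B (R' y))" for y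
    have adj: "inner (U x) y = inner x (U' y)" for x y
      by (simp add: U U'_def R_adj inner_add inner_diff I_adj B_adj IB)
    have sq: "s *\<^sub>R s *\<^sub>R y = y" for y :: 'a by (simp add: s)
    \<comment> \<open>This is \<open>(1/2 - s I B) (1/2 + s I B) = 1/4 + B\<^sup>2\<close>, valid
      because \<open>I\<^sup>2 = -1\<close> and \<open>I\<close> commutes with
      \<open>B\<close>.\<close>
    have cancel: "(1/2) *\<^sub>R ((1/2) *\<^sub>R x + s *\<^sub>R I (B x)) - s *\<^sub>R I (B ((1/2) *\<^sub>R x + s *\<^sub>R I (B x)))
        = X (X' x)" for x
      by (simp add: blinfun.bilinear_simps scaleR_diff_right scaleR_add_right II BB D_apply s
          scaleR_minus_right flip: IB)
    have "U (U' y) = y" for y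
    proof -
      have "(1/2) *\<^sub>R U' y + s *\<^sub>R I (B (U' y)) = X (X' (R' y))"
        unfolding cancel[symmetric] U'_def
        by (simp add: blinfun.bilinear_simps algebra_simps)
      then show ?thesis by (simp add: U RX RX')
    qed
    then have "surj U" by (metis surjI)
    moreover have "U' (U x) = x" for x
    proof -
      have "U' (U x) = (1/2) *\<^sub>R R' (R ((1/2) *\<^sub>R x + s *\<^sub>R I (B x)))
          - s *\<^sub>R I (B (R' (R ((1/2) *\<^sub>R x + s *\<^sub>R I (B x)))))"
        by (simp add: U'_def U)
      also have "\<dots> = R' (R (X (X' x)))"
        unfolding cancel[symmetric]
        by (simp add: blinfun.bilinear_simps IR IR' flip: CB)
      finally show ?thesis by (simp add: RX RX')
    qed
    then have "norm (U x) = norm x" for x by (simp add: norm_eq_sqrt_inner adj)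
    ultimately show ?thesis by blast
  qed
  define V where "V = R o\<^sub>L ((1/2) *\<^sub>R id_blinfun + 1 *\<^sub>R (I o\<^sub>L B))"
  define W where "W = R o\<^sub>L ((1/2) *\<^sub>R id_blinfun + (-1) *\<^sub>R (I o\<^sub>L B))"
  have V: "V x = R ((1/2) *\<^sub>R x + 1 *\<^sub>R I (B x))" and W: "W x = R ((1/2) *\<^sub>R x + (-1) *\<^sub>R I (B x))" for x
    by (simp_all add: V_def W_def blinfun.bilinear_simps)
  show thesis
  proof
    show "norm (V x) = norm x" "surj V" for x using key[OF V] by auto
    show "norm (W x) = norm x" "surj W" for x using key[OF W] by auto
    show "V x + W x = x + A x" for x
    proof -
      have "V x + W x = R ((1/2) *\<^sub>R x + (1/2) *\<^sub>R x)" by (simp add: V W flip: blinfun.add_right)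
      then show ?thesis by (simp add: R_apply flip: scaleR_left.add)
    qed
    show "Z o\<^sub>L V = V o\<^sub>L Z \<and> Z o\<^sub>L W = W o\<^sub>L Z"
      if "Z o\<^sub>L A = A o\<^sub>L Z" "Z o\<^sub>L A' = A' o\<^sub>L Z" "Z o\<^sub>L I = I o\<^sub>L Z" for Z
    proof -
      have Z: "Z (A x) = A (Z x)" "Z (A' x) = A' (Z x)" "Z (I x) = I (Z x)" for x
        using that by (metis blinfun_apply_blinfun_compose)+
      have "Z (R x) = R (Z x)" "Z (R' x) = R' (Z x)" for x
        by (simp_all add: R_apply blinfun.bilinear_simps Z)
      moreover from this have "Z (B x) = B (Z x)" for x by (rule comm_B)
      ultimately show ?thesis
        by (auto intro!: blinfun_eqI simp: V W blinfun.bilinear_simps Z)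
    qed
  qed
qed

section \<open>The Hilbert space of square-summable complex sequences\<close>

lemma cmod_add_sq_le: "(cmod (a + b))\<^sup>2 \<le> 2 * (cmod a)\<^sup>2 + 2 * (cmod b)\<^sup>2"
proof -
  have "(cmod (a + b))\<^sup>2 \<le> (cmod a + cmod b)\<^sup>2" by (intro power_mono norm_triangle_ineq) simp
  also have "\<dots> \<le> 2 * (cmod a)\<^sup>2 + 2 * (cmod b)\<^sup>2"
    using zero_le_power2[of "cmod a - cmod b"] by (simp add: power2_eq_square algebra_simps)
  finally show ?thesis .
qed

lemma sq_summable_add:
  fixes c d :: "nat \<Rightarrow> complex"
  assumes "summable (\<lambda>k. (cmod (c k))\<^sup>2)" "summable (\<lambda>k. (cmod (d k))\<^sup>2)"
  shows "summable (\<lambda>k. (cmod (c k + d k))\<^sup>2)"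
  by (rule summable_comparison_test'[where g = "\<lambda>k. 2 * (cmod (c k))\<^sup>2 + 2 * (cmod (d k))\<^sup>2"])
    (auto intro!: summable_add summable_mult assms cmod_add_sq_le)

lemma sq_summable_mult:
  fixes c :: "nat \<Rightarrow> complex"
  assumes "summable (\<lambda>k. (cmod (c k))\<^sup>2)"
  shows "summable (\<lambda>k. (cmod (a * c k))\<^sup>2)"
  by (simp add: norm_mult power_mult_distrib summable_mult assms)

text \<open>The type of the Krein space is only an abelian group, with its topology hidden in
  \<open>jnorm\<close>. The operator results above become applicable on a type of sequences made an
  instance of \<open>real_inner\<close> and \<open>banach\<close>.\<close>

typedef l2 = "{c :: nat \<Rightarrow> complex. summable (\<lambda>k. (cmod (c k))\<^sup>2)}"
  morphisms coord l2_of
  by (rule exI[of _ "\<lambda>_. 0"]) simp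

lemma summable_coord: "summable (\<lambda>k. (cmod (coord x k))\<^sup>2)"
  using coord[of x] by simp

lemma coord_l2_of: "summable (\<lambda>k. (cmod (c k))\<^sup>2) \<Longrightarrow> coord (l2_of c) = c"
  by (simp add: l2_of_inverse)

lemma l2_eqI: "(\<And>k. coord x k = coord y k) \<Longrightarrow> x = y"
  by (simp add: coord_inject[symmetric] fun_eq_iff)

definition cscale :: "complex \<Rightarrow> l2 \<Rightarrow> l2" where
  "cscale a x = l2_of (\<lambda>k. a * coord x k)"

lemma coord_cscale [simp]: "coord (cscale a x) k = a * coord x k"
  by (simp add: cscale_def coord_l2_of sq_summable_mult summable_coord)

lemma summable_inner_coord: "summable (\<lambda>k. inner (coord x k) (coord y k))"
proof (rule summable_comparison_test'[where g = "\<lambda>k. (cmod (coord x k))\<^sup>2 + (cmod (coord y k))\<^sup>2"])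
  show "summable (\<lambda>k. (cmod (coord x k))\<^sup>2 + (cmod (coord y k))\<^sup>2)"
    by (intro summable_add summable_coord)
  fix k
  have "norm (inner (coord x k) (coord y k)) \<le> cmod (coord x k) * cmod (coord y k)"
    using Cauchy_Schwarz_ineq2 by simp
  also have "\<dots> \<le> (cmod (coord x k))\<^sup>2 + (cmod (coord y k))\<^sup>2"
    using sum_squares_bound[of "cmod (coord x k)" "cmod (coord y k)"]
      mult_nonneg_nonneg[OF norm_ge_zero norm_ge_zero, of "coord x k" "coord y k"] by linarith
  finally show "norm (inner (coord x k) (coord y k)) \<le> (cmod (coord x k))\<^sup>2 + (cmod (coord y k))\<^sup>2" .
qed

instantiation l2 :: real_inner
begin

definition "0 = l2_of (\<lambda>_. 0)"
definition "x + y = l2_of (\<lambda>k. coord x k + coord y k)"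
definition "- x = cscale (-1) x"
definition "x - y = x + - (y :: l2)"
definition "r *\<^sub>R x = cscale (complex_of_real r) x"
definition "inner x y = (\<Sum>k. inner (coord x k) (coord y k))"
definition norm_l2_def: "norm (x :: l2) = sqrt (inner x x)"
definition "dist x y = norm (x - y :: l2)"
definition "sgn x = inverse (norm (x :: l2)) *\<^sub>R x"
definition "(uniformity :: (l2 \<times> l2) filter) = (INF e\<in>{0<..}. principal {(x, y). dist x y < e})"
definition "open (U :: l2 set) = (\<forall>x\<in>U. eventually (\<lambda>(x', y). x' = x \<longrightarrow> y \<in> U) uniformity)"

lemma coord_zero: "coord 0 k = 0"
  and coord_add: "coord (x + y) k = coord x k + coord y k"
  and coord_uminus: "coord (- x) k = - coord x k"
  by (simp_all add: zero_l2_def plus_l2_def uminus_l2_def coord_l2_of sq_summable_add summable_coord)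

lemma coord_diff: "coord (x - y) k = coord x k - coord y k"
  and coord_scaleR: "coord (r *\<^sub>R x) k = complex_of_real r * coord x k"
  by (simp_all add: minus_l2_def coord_add coord_uminus scaleR_l2_def)

instance
proof
  fix x y z :: l2 and a b r :: real
  show "x + y + z = x + (y + z)" "x + y = y + x" "0 + x = x" "- x + x = 0" "x - y = x + - y"
    "a *\<^sub>R (x + y) = a *\<^sub>R x + a *\<^sub>R y" "(a + b) *\<^sub>R x = a *\<^sub>R x + b *\<^sub>R x"
    "a *\<^sub>R b *\<^sub>R x = (a * b) *\<^sub>R x" "1 *\<^sub>R x = x"
    by (auto intro!: l2_eqI simp: coord_zero coord_add coord_uminus coord_diff coord_scaleR algebra_simps)
  show "inner x y = inner y x" by (simp add: inner_l2_def inner_commute)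
  show "inner (x + y) z = inner x z + inner y z"
    by (simp add: inner_l2_def coord_add inner_add_left suminf_add summable_inner_coord)
  show "inner (r *\<^sub>R x) y = r * inner x y"
    by (simp add: inner_l2_def coord_scaleR suminf_mult summable_inner_coord flip: scaleR_conv_of_real)
  show "0 \<le> inner x x" by (simp add: inner_l2_def suminf_nonneg summable_inner_coord)
  show "inner x x = 0 \<longleftrightarrow> x = 0"
    by (auto simp: inner_l2_def suminf_eq_zero_iff summable_inner_coord coord_zero intro!: l2_eqI)
qed (simp_all add: dist_l2_def sgn_l2_def uniformity_l2_def open_l2_def norm_l2_def)

end

lemmas coord_simps [simp] = coord_zero coord_add coord_uminus coord_diff coord_scaleR

lemma coord_sum [simp]: "coord (\<Sum>i\<in>A. f i) k = (\<Sum>i\<in>A. coord (f i) k)"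
  by (induction A rule: infinite_finite_induct) simp_all

lemma norm_l2_sq: "(norm x)\<^sup>2 = (\<Sum>k. (cmod (coord x k))\<^sup>2)"
  by (simp add: power2_norm_eq_inner inner_l2_def)

lemma sum_coord_le: "finite A \<Longrightarrow> (\<Sum>k\<in>A. (cmod (coord x k))\<^sup>2) \<le> (norm x)\<^sup>2"
  unfolding norm_l2_sq by (intro sum_le_suminf summable_coord) auto

lemma cmod_coord_le: "cmod (coord x k) \<le> norm x"
  using sum_coord_le[of "{k}" x] by (auto intro: power2_le_imp_le)

lemma tendsto_coord:
  assumes "(f \<longlongrightarrow> x) F"
  shows "((\<lambda>n. coord (f n) k) \<longlongrightarrow> coord x k) F"
proof -
  have "bounded_linear (\<lambda>x. coord x k)"
    by (rule bounded_linear_intro[where K = 1]) (simp_all add: cmod_coord_le scaleR_conv_of_real)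
  then show ?thesis using assms by (rule bounded_linear.tendsto)
qed

lemma l2_bounded_sums:
  assumes "0 \<le> b" and le: "\<And>N. (\<Sum>k<N. (cmod (c k))\<^sup>2) \<le> b\<^sup>2"
  shows "summable (\<lambda>k. (cmod (c k))\<^sup>2)" "norm (l2_of c) \<le> b"
proof -
  show *: "summable (\<lambda>k. (cmod (c k))\<^sup>2)"
    by (rule summableI_nonneg_bounded[OF _ le]) simp
  have "(norm (l2_of c))\<^sup>2 \<le> b\<^sup>2"
    unfolding norm_l2_sq coord_l2_of[OF *] by (intro suminf_le_const * le)
  then show "norm (l2_of c) \<le> b" using \<open>0 \<le> b\<close> by (rule power2_le_imp_le)
qed

text \<open>The limit is taken coordinatewise. Closeness in norm survives because it is tested on
  finite sums of coordinates, where the limit passes through each term.\<close>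

instance l2 :: banach
proof
  fix X :: "nat \<Rightarrow> l2" assume X: "Cauchy X"
  have "Cauchy (\<lambda>n. coord (X n) k)" for k
  proof (rule metric_CauchyI)
    fix e :: real assume "e > 0"
    with X obtain M where "\<And>m n. m \<ge> M \<Longrightarrow> n \<ge> M \<Longrightarrow> dist (X m) (X n) < e"
      by (meson metric_CauchyD)
    moreover have "dist (coord (X m) k) (coord (X n) k) \<le> dist (X m) (X n)" for m n
      using cmod_coord_le[of "X m - X n" k] by (simp add: dist_norm)
    ultimately show "\<exists>M. \<forall>m\<ge>M. \<forall>n\<ge>M. dist (coord (X m) k) (coord (X n) k) < e"
      by (meson le_less_trans)
  qed
  then obtain c where c: "\<And>k. (\<lambda>n. coord (X n) k) \<longlonglongrightarrow> c k"
    unfolding Cauchy_convergent_iff convergent_def by metis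
  have close: "\<exists>M. \<forall>m\<ge>M. summable (\<lambda>k. (cmod (coord (X m) k - c k))\<^sup>2) \<and>
      norm (l2_of (\<lambda>k. coord (X m) k - c k)) \<le> e" if "e > 0" for e
  proof -
    obtain M where M: "\<And>m n. m \<ge> M \<Longrightarrow> n \<ge> M \<Longrightarrow> dist (X m) (X n) < e"
      using X \<open>e > 0\<close> by (meson metric_CauchyD)
    have "(\<Sum>k<N. (cmod (coord (X m) k - c k))\<^sup>2) \<le> e\<^sup>2" if "m \<ge> M" for m N
    proof (rule LIMSEQ_le_const2)
      show "(\<lambda>n. \<Sum>k<N. (cmod (coord (X m) k - coord (X n) k))\<^sup>2)
          \<longlonglongrightarrow> (\<Sum>k<N. (cmod (coord (X m) k - c k))\<^sup>2)"
        by (intro tendsto_intros c)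
      have "(\<Sum>k<N. (cmod (coord (X m) k - coord (X n) k))\<^sup>2) \<le> e\<^sup>2" if "n \<ge> M" for n
      proof -
        have "(\<Sum>k<N. (cmod (coord (X m) k - coord (X n) k))\<^sup>2) \<le> (norm (X m - X n))\<^sup>2"
          using sum_coord_le[of "{..<N}" "X m - X n"] by simp
        also have "\<dots> \<le> e\<^sup>2"
          using M[OF \<open>m \<ge> M\<close> \<open>n \<ge> M\<close>] by (intro power_mono) (simp_all add: dist_norm)
        finally show ?thesis .
      qed
      then show "\<exists>M. \<forall>n\<ge>M. (\<Sum>k<N. (cmod (coord (X m) k - coord (X n) k))\<^sup>2) \<le> e\<^sup>2" by blast
    qed
    then show ?thesis using l2_bounded_sums[of e] \<open>e > 0\<close> by (meson less_imp_le)
  qed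
  obtain M where "summable (\<lambda>k. (cmod (coord (X M) k - c k))\<^sup>2)" using close[of 1] by auto
  \<comment> \<open>The limit is square-summable, being the sum of \<open>X M\<close> and
    \<open>c - X M\<close>.\<close>
  from sq_summable_add[OF sq_summable_mult[OF this, of "-1"] summable_coord[of "X M"]]
  have c_coord: "coord (l2_of c) = c" by (intro coord_l2_of) simp
  have eq: "X m - l2_of c = l2_of (\<lambda>k. coord (X m) k - c k)"
    if "summable (\<lambda>k. (cmod (coord (X m) k - c k))\<^sup>2)" for m
    using that by (intro l2_eqI) (simp add: coord_l2_of c_coord)
  have "X \<longlonglongrightarrow> l2_of c"
  proof (rule metric_LIMSEQ_I)
    fix e :: real assume "e > 0"
    then obtain M where "\<forall>m\<ge>M. summable (\<lambda>k. (cmod (coord (X m) k - c k))\<^sup>2) \<and>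
        norm (l2_of (\<lambda>k. coord (X m) k - c k)) \<le> e / 2"
      using close[of "e / 2"] by auto
    then have "dist (X m) (l2_of c) < e" if "m \<ge> M" for m
      using eq[of m] that \<open>e > 0\<close> by (fastforce simp: dist_norm)
    then show "\<exists>M. \<forall>m\<ge>M. dist (X m) (l2_of c) < e"
by blast
  qed
  then show "convergent X" by (auto simp: convergent_def)
qed

section \<open>Complex scalars, unit vectors and the Hermitian product on \<open>l2\<close>\<close>

lemma cscale_simps [simp]:
  "cscale a (x + y) = cscale a x + cscale a y" "cscale a (x - y) = cscale a x - cscale a y"
  "cscale a (r *\<^sub>R x) = r *\<^sub>R cscale a x" "cscale a (cscale b x) = cscale (a * b) x"
  "cscale a 0 = 0" "cscale 0 x = 0" "cscale 1 x = x" "cscale (-1) x = - x"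
  "cscale (complex_of_real r) x = r *\<^sub>R x"
  by (auto intro!: l2_eqI simp: algebra_simps)

lemma norm_cscale [simp]: "norm (cscale a x) = cmod a * norm x"
proof -
  have "(norm (cscale a x))\<^sup>2 = (cmod a * norm x)\<^sup>2"
    by (simp add: norm_l2_sq power_mult_distrib norm_mult suminf_mult summable_coord)
  then show ?thesis by (simp add: power2_eq_iff_nonneg)
qed

lemma inner_cscale: "inner x (cscale a y) = inner (cscale (cnj a) x) y"
  by (simp add: inner_l2_def inner_complex_def algebra_simps)

lemma bounded_linear_cscale: "bounded_linear (cscale a)"
  by (rule bounded_linear_intro[where K = "cmod a"]) simp_all

definition unit_seq :: "nat \<Rightarrow> l2" where
  "unit_seq j = l2_of (\<lambda>k. if k = j then 1 else 0)"

lemma coord_unit_seq [simp]: "coord (unit_seq j) k = (if k = j then 1 else 0)"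
proof -
  have "summable (\<lambda>k. (cmod (if k = j then 1 else 0))\<^sup>2)"
    by (rule summable_finite[of "{j}"]) auto
  then show ?thesis by (simp add: unit_seq_def coord_l2_of)
qed

lemma inner_unit_seq: "inner x (cscale a (unit_seq j)) = inner (coord x j) a"
proof -
  have "inner x (cscale a (unit_seq j)) = (\<Sum>k\<in>{j}. inner (coord x k) (a * (if k = j then 1 else 0)))"
    unfolding inner_l2_def by (subst suminf_finite[of "{j}"]) auto
  then show ?thesis by simp
qed

lemma norm_unit_seq [simp]: "norm (unit_seq j) = 1"
  using inner_unit_seq[of "unit_seq j" 1 j] by (simp add: norm_eq_sqrt_inner)

lemma coord_partial_sum:
  "coord (\<Sum>j<n. cscale (c j) (unit_seq j)) k = (if k < n then c k else 0)"
  by (simp add: if_distrib[of "(*) _"] sum.If_cases cong: if_cong)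

text \<open>The squared error of a truncation is a tail of the convergent series for the squared
  norm.\<close>

lemma l2_expansion: "(\<lambda>n. \<Sum>j<n. cscale (coord x j) (unit_seq j)) \<longlonglongrightarrow> x"
proof -
  have "(norm ((\<Sum>j<n. cscale (coord x j) (unit_seq j)) - x))\<^sup>2 =
      (norm x)\<^sup>2 - (\<Sum>k<n. (cmod (coord x k))\<^sup>2)" for n
  proof -
    have "(norm ((\<Sum>j<n. cscale (coord x j) (unit_seq j)) - x))\<^sup>2 =
        (\<Sum>k. if k < n then 0 else (cmod (coord x k))\<^sup>2)"
      unfolding norm_l2_sq coord_diff coord_partial_sum by (rule suminf_cong) simp
    also have "\<dots> = (\<Sum>k. (cmod (coord x k))\<^sup>2 - (if k < n then (cmod (coord x k))\<^sup>2 else 0))"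
      by (rule suminf_cong) simp
    also have "\<dots> = (norm x)\<^sup>2 - (\<Sum>k. if k < n then (cmod (coord x k))\<^sup>2 else 0)"
      unfolding norm_l2_sq
      by (rule suminf_diff[symmetric, OF summable_coord]) (rule summable_finite[of "{..<n}"], auto)
    also have "(\<Sum>k. if k < n then (cmod (coord x k))\<^sup>2 else 0) = (\<Sum>k<n. (cmod (coord x k))\<^sup>2)"
      by (subst suminf_finite[of "{..<n}"]) auto
    finally show ?thesis .
  qed
  moreover have "(\<lambda>n. (norm x)\<^sup>2 - (\<Sum>k<n. (cmod (coord x k))\<^sup>2)) \<longlonglongrightarrow> (norm x)\<^sup>2 - (norm x)\<^sup>2"
    unfolding norm_l2_sq by (intro tendsto_intros summable_LIMSEQ summable_coord)
  ultimately have "(\<lambda>n. (norm ((\<Sum>j<n. cscale (coord x j) (unit_seq j)) - x))\<^sup>2) \<longlonglongrightarrow> 0" by simp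
  from tendsto_real_sqrt[OF this] show ?thesis
    by (simp add: tendsto_norm_zero_iff LIM_zero_iff)
qed

lemma l2_expansion_unique:
  assumes "(\<lambda>n. \<Sum>j<n. cscale (c j) (unit_seq j)) \<longlonglongrightarrow> x"
  shows "c = coord x"
proof
  fix k
  have "(\<lambda>n. coord (\<Sum>j<n. cscale (c j) (unit_seq j)) k) \<longlonglongrightarrow> coord x k"
    by (rule tendsto_coord[OF assms])
  moreover have "(\<lambda>n. coord (\<Sum>j<n. cscale (c j) (unit_seq j)) k) \<longlonglongrightarrow> c k"
    unfolding coord_partial_sum
    by (rule tendsto_eventually, rule eventually_mono[OF eventually_gt_at_top[of k]]) simp
  ultimately show "c k = coord x k" using LIMSEQ_unique by blast
qed

text \<open>The Hermitian product recovered from its real part: a form that is linear in its first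
  argument satisfies \<open>Re <x, i y> = Im <x, y>\<close>.\<close>

definition cinner :: "l2 \<Rightarrow> l2 \<Rightarrow> complex" where
  "cinner x y = Complex (inner x y) (inner x (cscale \<i> y))"

text \<open>A complex number is determined by its real pairings with \<open>1\<close> and
  \<open>\<i>\<close>; in this way complex identities are obtained from real ones.\<close>

lemma inner_cscale_right: "inner x (cscale a y) = inner (cinner x y) a"
proof -
  have "cscale a y = Re a *\<^sub>R y + Im a *\<^sub>R cscale \<i> y"
    by (rule l2_eqI) (simp add: complex_eq_iff)
  then show ?thesis by (simp add: inner_add_right cinner_def inner_complex_def)
qed

lemma cinner_cscale_left: "cinner (cscale a x) y = a * cinner x y"
proof -
  have "inner (cscale a x) (cscale b y) = inner (a * cinner x y) b" for b
  proof -
    have "inner (cscale a x) (cscale b y) = inner x (cscale (cnj a * b) y)"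
      using inner_cscale[of x "cnj a" "cscale b y"] by simp
    then show ?thesis by (simp add: inner_cscale_right inner_complex_def algebra_simps)
  qed
  from this[of 1] this[of \<i>] show ?thesis
    by (simp add: complex_eq_iff inner_complex_def cinner_def)
qed

lemma cinner_add_left: "cinner (x + y) z = cinner x z + cinner y z"
  by (simp add: cinner_def inner_add_left complex_eq_iff)

text \<open>The synthesis operator of a Bessel sequence is the adjoint of its analysis operator
  \<open>x \<mapsto> (cinner x (g k))\<^sub>k\<close>.\<close>

lemma synthesis_operator_exists:
  assumes bessel: "\<And>x. summable (\<lambda>k. (cmod (cinner x (g k)))\<^sup>2)"
    "\<And>x. (\<Sum>k. (cmod (cinner x (g k)))\<^sup>2) \<le> b * (norm x)\<^sup>2"
  obtains T :: "l2 \<Rightarrow>\<^sub>L l2" where "\<And>k. T (unit_seq k) = g k" "\<And>a x. T (cscale a x) = cscale a (T x)"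
proof -
  define G where "G x = l2_of (\<lambda>k. cinner x (g k))" for x
  have coord_G: "coord (G x) k = cinner x (g k)" for x k
    by (simp add: G_def coord_l2_of bessel)
  have "bounded_linear G"
  proof (rule bounded_linear_intro)
    show "G (x + y) = G x + G y" for x y
      by (rule l2_eqI) (simp add: coord_G cinner_add_left)
    show "G (r *\<^sub>R x) = r *\<^sub>R G x" for r x
      using cinner_cscale_left[of "complex_of_real r" x] by (intro l2_eqI) (simp add: coord_G)
    show "norm (G x) \<le> norm x * sqrt \<bar>b\<bar>" for x
    proof (rule power2_le_imp_le)
      have "(norm (G x))\<^sup>2 \<le> b * (norm x)\<^sup>2" by (simp add: norm_l2_sq[of "G x"] coord_G bessel)
      also have "\<dots> \<le> \<bar>b\<bar> * (norm x)\<^sup>2" by (intro mult_right_mono) auto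
      finally show "(norm (G x))\<^sup>2 \<le> (norm x * sqrt \<bar>b\<bar>)\<^sup>2"
        by (simp add: power_mult_distrib mult.commute)
    qed simp
  qed
  obtain T where T: "\<And>x y. inner (Blinfun G x) y = inner x (blinfun_apply T y)"
    using blinfun_adjoint_exists[of "Blinfun G"] by blast
  have T: "inner x (T y) = inner (G x) y" for x y
    using T \<open>bounded_linear G\<close> by (simp add: bounded_linear_Blinfun_apply)
  show thesis
  proof
    show "T (unit_seq k) = g k" for k
    proof (rule vector_eq_ldot[THEN iffD1], rule allI)
      show "inner x (T (unit_seq k)) = inner x (g k)" for x
        using inner_unit_seq[of "G x" 1 k] inner_cscale_right[of x 1 "g k"] by (simp add: T coord_G)
    qed
    show "T (cscale a y) = cscale a (T y)" for a y
    proof (rule vector_eq_ldot[THEN iffD1], rule allI)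
      fix x
      have "cscale (cnj a) (G x) = G (cscale (cnj a) x)"
        by (rule l2_eqI) (simp add: coord_G cinner_cscale_left)
      then show "inner x (T (cscale a y)) = inner x (cscale a (T y))"
        by (simp add: T inner_cscale)
    qed
  qed
qed

section \<open>Coordinate projections and reindexings\<close>

definition l2_restrict :: "nat set \<Rightarrow> l2 \<Rightarrow> l2" where
  "l2_restrict S x = l2_of (\<lambda>k. if k \<in> S then coord x k else 0)"

lemma coord_l2_restrict [simp]: "coord (l2_restrict S x) k = (if k \<in> S then coord x k else 0)"
proof -
  have "summable (\<lambda>k. (cmod (if k \<in> S then coord x k else 0))\<^sup>2)"
    by (rule summable_comparison_test'[OF summable_coord[of x]]) simp
  then show ?thesis by (simp add: l2_restrict_def coord_l2_of)
qed

lemma inner_l2_restrict: "inner (l2_restrict S x) y = inner x (l2_restrict S y)"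
  unfolding inner_l2_def by (rule suminf_cong) simp

lemma norm_l2_restrict_le: "norm (l2_restrict S x) \<le> norm x"
  by (rule power2_le_imp_le)
    (simp_all add: norm_l2_sq[of "l2_restrict S x"] suminf_le_const summable_coord[of "l2_restrict S x", simplified]
      order_trans[OF sum_mono sum_coord_le])

lemma bounded_linear_l2_restrict: "bounded_linear (l2_restrict S)"
  by (rule bounded_linear_intro[where K = 1])
    (auto intro!: l2_eqI simp: norm_l2_restrict_le)

text \<open>For injective \<open>s\<close> this is the adjoint of the isometry
  \<open>unit_seq k \<mapsto> unit_seq (s k)\<close>: it sends \<open>unit_seq (s k)\<close> back to
  \<open>unit_seq k\<close> and annihilates the unit vectors outside the range of
  \<open>s\<close>.\<close>

definition l2_reindex :: "(nat \<Rightarrow> nat) \<Rightarrow> l2 \<Rightarrow> l2" where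
  "l2_reindex s x = l2_of (\<lambda>k. coord x (s k))"

lemma sum_reindex_coord_le:
  fixes s :: "nat \<Rightarrow> nat"
  assumes "inj s"
  shows "(\<Sum>k<n. (cmod (coord x (s k)))\<^sup>2) \<le> (norm x)\<^sup>2"
  using sum_coord_le[OF finite_imageI[OF finite_lessThan, of s n], of x] inj_on_subset[OF assms subset_UNIV, of "{..<n}"]
  by (simp add: sum.reindex)

lemma coord_l2_reindex:
  assumes "inj s"
  shows "coord (l2_reindex s x) k = coord x (s k)"
  unfolding l2_reindex_def
  by (subst coord_l2_of) (use l2_bounded_sums(1)[OF norm_ge_zero sum_reindex_coord_le[OF assms]] in auto)

lemma norm_l2_reindex_le: "inj s \<Longrightarrow> norm (l2_reindex s x) \<le> norm x"
  unfolding l2_reindex_def by (rule l2_bounded_sums(2)[OF norm_ge_zero sum_reindex_coord_le])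

lemma bounded_linear_l2_reindex: "inj s \<Longrightarrow> bounded_linear (l2_reindex s)"
  by (rule bounded_linear_intro[where K = 1])
    (auto intro!: l2_eqI simp: norm_l2_reindex_le coord_l2_reindex)

text \<open>The two images use disjoint sets of coordinates of \<open>x\<close>. So contractions
  applied to them can be added without losing contractivity, provided that their ranges are
  orthogonal.\<close>

lemma norm_l2_reindex_disjoint:
  assumes "inj s" "inj t" "range s \<inter> range t = {}"
  shows "(norm (l2_reindex s x))\<^sup>2 + (norm (l2_reindex t x))\<^sup>2 \<le> (norm x)\<^sup>2"
proof -
  let ?f = "\<lambda>k. (cmod (coord x k))\<^sup>2"
  have sm: "summable (\<lambda>k. ?f (s k))" "summable (\<lambda>k. ?f (t k))"
    using summable_coord[of "l2_reindex s x"] summable_coord[of "l2_reindex t x"] assms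
    by (simp_all add: coord_l2_reindex)
  have "(norm (l2_reindex s x))\<^sup>2 + (norm (l2_reindex t x))\<^sup>2 = (\<Sum>k. ?f (s k) + ?f (t k))"
    by (simp add: norm_l2_sq[of "l2_reindex _ x"] coord_l2_reindex assms suminf_add sm)
  also have "\<dots> \<le> (norm x)\<^sup>2"
  proof (rule suminf_le_const)
    fix n
    have inj: "inj_on s {..<n}" "inj_on t {..<n}"
      using assms(1,2) by (blast intro: inj_on_subset)+
    have "(\<Sum>k<n. ?f (s k) + ?f (t k)) = sum ?f (s ` {..<n}) + sum ?f (t ` {..<n})"
      by (simp add: sum.distrib sum.reindex inj)
    also have "\<dots> = sum ?f (s ` {..<n} \<union> t ` {..<n})"
      using assms(3) by (intro sum.union_disjoint[symmetric]) auto
    also have "\<dots> \<le> (norm x)\<^sup>2" by (intro sum_coord_le) simp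
    finally show "(\<Sum>k<n. ?f (s k) + ?f (t k)) \<le> (norm x)\<^sup>2" .
  qed (intro summable_add sm)
  finally show ?thesis .
qed

text \<open>Complex multiples of the unit vectors are tested because the operators are only
  real-linear; the density of finite sums does the rest.\<close>

lemma l2_operator_eqI:
  assumes "bounded_linear F" "bounded_linear G"
    and "\<And>a k. F (cscale a (unit_seq k)) = G (cscale a (unit_seq k))"
  shows "F x = G x"
proof -
  interpret F: bounded_linear F by fact
  interpret G: bounded_linear G by fact
  let ?s = "\<lambda>n. \<Sum>j<n. cscale (coord x j) (unit_seq j)"
  have "(\<lambda>n. F (?s n)) \<longlonglongrightarrow> F x" "(\<lambda>n. G (?s n)) \<longlonglongrightarrow> G x"
    by (intro F.tendsto G.tendsto l2_expansion)+
  then show ?thesis by (simp add: F.sum G.sum assms(3) LIMSEQ_unique)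
qed

text \<open>\<open>A\<close> sends \<open>unit_seq (s k)\<close> to \<open>Tp (unit_seq k)\<close>
  times \<open>(1 - \<epsilon>) / \<tau>p\<close>, and \<open>unit_seq (t k)\<close> to
  \<open>Tm (unit_seq k)\<close> times \<open>(1 - \<epsilon>) / \<tau>m\<close>. Solving
  \<open>V + W = 1 + A\<close> for these values leaves the term \<open>- unit_seq\<close>.\<close>

proposition l2_pair_sum_unitaries:
  fixes Tp Tm :: "l2 \<Rightarrow>\<^sub>L l2" and s t :: "nat \<Rightarrow> nat"
  assumes "inj s" "inj t" "range s = S" "range t = - S"
    and Tp: "\<And>a x. Tp (cscale a x) = cscale a (Tp x)" "\<And>x. l2_restrict S (Tp x) = Tp x"
      "\<And>x. norm (Tp x) \<le> \<tau>p * norm x"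
    and Tm: "\<And>a x. Tm (cscale a x) = cscale a (Tm x)" "\<And>x. l2_restrict S (Tm x) = 0"
      "\<And>x. norm (Tm x) \<le> \<tau>m * norm x"
    and "0 < \<epsilon>" "\<epsilon> < 1"
  obtains V W :: "l2 \<Rightarrow>\<^sub>L l2" where
    "\<And>x. norm (V x) = norm x" "surj V" "\<And>a x. V (cscale a x) = cscale a (V x)"
    "\<And>x. V (l2_restrict S x) = l2_restrict S (V x)"
    "\<And>x. norm (W x) = norm x" "surj W" "\<And>a x. W (cscale a x) = cscale a (W x)"
    "\<And>x. W (l2_restrict S x) = l2_restrict S (W x)"
    "\<And>k. Tp (unit_seq k) = (\<tau>p / (1 - \<epsilon>)) *\<^sub>R (V (unit_seq (s k)) + W (unit_seq (s k)) - unit_seq (s k))"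
    "\<And>k. Tm (unit_seq k) = (\<tau>m / (1 - \<epsilon>)) *\<^sub>R (V (unit_seq (t k)) + W (unit_seq (t k)) - unit_seq (t k))"
proof -
  have "range s \<inter> range t = {}" using assms(3,4) by blast
  have st: "s k \<in> S" "t k \<notin> S" "s k \<noteq> t m" "t m \<noteq> s k" for k m using assms(3,4) by blast+
  have \<tau>_nonneg: "0 \<le> \<tau>p" "0 \<le> \<tau>m"
    using order_trans[OF norm_ge_zero Tp(3)[of "unit_seq 0"]]
      order_trans[OF norm_ge_zero Tm(3)[of "unit_seq 0"]] by simp_all
  \<comment> \<open>If \<open>\<tau>p = 0\<close>, then \<open>1 / \<tau>p\<close> is 0 by
    convention, while the norm bound forces \<open>Tp = 0\<close>, and the claim about
    \<open>Tp\<close> becomes \<open>0 = 0\<close>. The same goes for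
    \<open>\<tau>m\<close>.\<close>
  define Ap where "Ap x = (1 / \<tau>p) *\<^sub>R Tp (l2_reindex s x)" for x
  define Am where "Am x = (1 / \<tau>m) *\<^sub>R Tm (l2_reindex t x)" for x
  have Ap: "norm (Ap x) \<le> norm (l2_reindex s x)" and Am: "norm (Am x) \<le> norm (l2_reindex t x)" for x
    using Tp(3)[of "l2_reindex s x"] Tm(3)[of "l2_reindex t x"] \<tau>_nonneg
    by (auto simp: Ap_def Am_def divide_le_eq mult.commute)
  have bl: "bounded_linear (l2_reindex s)" "bounded_linear (l2_reindex t)"
    by (intro bounded_linear_l2_reindex assms)+
  have bl_A: "bounded_linear (\<lambda>x. (1 - \<epsilon>) *\<^sub>R (Ap x + Am x))"
    unfolding Ap_def Am_def
    by (intro bounded_linear_const_scaleR bounded_linear_add blinfun.bounded_linear_right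
        bounded_linear_compose[OF _ bl(1)] bounded_linear_compose[OF _ bl(2)])
  define A where "A = Blinfun (\<lambda>x. (1 - \<epsilon>) *\<^sub>R (Ap x + Am x))"
  have A: "A x = (1 - \<epsilon>) *\<^sub>R (Ap x + Am x)" for x
    by (simp add: A_def bounded_linear_Blinfun_apply bl_A)
  have restrict_lin: "l2_restrict S (x + y) = l2_restrict S x + l2_restrict S y"
    "l2_restrict S (r *\<^sub>R x) = r *\<^sub>R l2_restrict S x" for x y r
    using bounded_linear_l2_restrict[of S] by (simp_all add: linear_simps)
  have restrict_A: "l2_restrict S (Ap x) = Ap x" "l2_restrict S (Am x) = 0" for x
    by (simp_all add: Ap_def Am_def restrict_lin Tp(2) Tm(2))
  have "norm A \<le> 1 - \<epsilon>"
  proof (rule norm_blinfun_bound)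
    fix x
    \<comment> \<open>\<open>Ap x\<close> is supported in \<open>S\<close> and \<open>Am x\<close>
      off \<open>S\<close>, so Pythagoras applies to the outputs; for the inputs the ranges of
      \<open>s\<close> and \<open>t\<close> are disjoint.\<close>
    have "inner (Ap x) (Am x) = 0"
      using inner_l2_restrict[of S "Ap x" "Am x"] by (simp add: restrict_A)
    then have "(norm (Ap x + Am x))\<^sup>2 = (norm (Ap x))\<^sup>2 + (norm (Am x))\<^sup>2"
      by (simp add: power2_norm_eq_inner inner_add inner_commute)
    also have "\<dots> \<le> (norm (l2_reindex s x))\<^sup>2 + (norm (l2_reindex t x))\<^sup>2"
      by (intro add_mono power_mono Ap Am) auto
    also have "\<dots> \<le> (norm x)\<^sup>2" by (rule norm_l2_reindex_disjoint) fact+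
    finally have "norm (Ap x + Am x) \<le> norm x" by (rule power2_le_imp_le) simp
    then show "norm (A x) \<le> (1 - \<epsilon>) * norm x" using \<open>\<epsilon> < 1\<close> by (simp add: A)
  qed (use \<open>\<epsilon> < 1\<close> in simp)
  then have "norm A < 1" using \<open>0 < \<epsilon>\<close> by simp
  have A_restrict: "A (l2_restrict S x) = l2_restrict S (A x)" for x
  proof -
    \<comment> \<open>Block diagonality: the coordinates in \<open>S\<close> feed only
      \<open>Ap\<close>, whose values are supported in \<open>S\<close>.\<close>
    have "l2_reindex s (l2_restrict S x) = l2_reindex s x" "l2_reindex t (l2_restrict S x) = 0"
      by (auto intro!: l2_eqI simp: coord_l2_reindex assms(1,2) st)
    then show ?thesis
      by (simp add: A restrict_lin restrict_A) (simp add: Ap_def Am_def blinfun.bilinear_simps)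
  qed
  have A_cscale: "A (cscale a x) = cscale a (A x)" for a x
  proof -
    have "l2_reindex u (cscale a x) = cscale a (l2_reindex u x)" if "inj u" for u
      using that by (auto intro!: l2_eqI simp: coord_l2_reindex)
    then show ?thesis using assms(1,2) by (simp add: A Ap_def Am_def Tp(1) Tm(1))
  qed
  obtain A' :: "l2 \<Rightarrow>\<^sub>L l2" where A': "\<And>x y. inner (A x) y = inner x (A' y)"
    using blinfun_adjoint_exists[of A] by blast
  define C where "C a = Blinfun (cscale a)" for a
  define Q where "Q = Blinfun (l2_restrict S)"
  have C: "C a x = cscale a x" and Q: "Q x = l2_restrict S x" for a x
    by (simp_all add: C_def Q_def bounded_linear_Blinfun_apply bounded_linear_cscale
        bounded_linear_l2_restrict)
  \<comment> \<open>The commutation property of \<open>V\<close> and \<open>W\<close> asks for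
    \<open>A'\<close> as well. Taking adjoints turns \<open>cscale a\<close> into
    \<open>cscale (cnj a)\<close> and fixes the projection.\<close>
  have A'_cscale: "A' (cscale a x) = cscale a (A' x)" for a x
  proof (rule vector_eq_ldot[THEN iffD1], rule allI)
    show "inner z (A' (cscale a x)) = inner z (cscale a (A' x))" for z
      by (simp add: inner_cscale A_cscale flip: A')
  qed
  have A'_restrict: "A' (l2_restrict S x) = l2_restrict S (A' x)" for x
  proof (rule vector_eq_ldot[THEN iffD1], rule allI)
    show "inner z (A' (l2_restrict S x)) = inner z (l2_restrict S (A' x))" for z
      by (simp add: A_restrict flip: A' inner_l2_restrict)
  qed
  have neg_i: "cscale (- \<i>) x = - cscale \<i> x" for x by (rule l2_eqI) simp
  obtain V W :: "l2 \<Rightarrow>\<^sub>L l2" where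
    VW: "\<And>x. norm (V x) = norm x" "surj V" "\<And>x. norm (W x) = norm x" "surj W"
      "\<And>x. V x + W x = x + A x"
    and comm: "\<And>Z. \<lbrakk>Z o\<^sub>L A = A o\<^sub>L Z; Z o\<^sub>L A' = A' o\<^sub>L Z; Z o\<^sub>L C \<i> = C \<i> o\<^sub>L Z\<rbrakk>
       \<Longrightarrow> Z o\<^sub>L V = V o\<^sub>L Z \<and> Z o\<^sub>L W = W o\<^sub>L Z"
    by (rule one_plus_contraction_sum_unitaries[OF \<open>norm A < 1\<close> A', of "C \<i>"])
      (auto simp: C A_cscale inner_cscale[of _ \<i>] neg_i)
  \<comment> \<open>The same commutation property yields complex linearity when used with scalar
    multiplications, and compatibility with the splitting when used with \<open>Q\<close>.\<close>
  have comm_C: "C a o\<^sub>L V = V o\<^sub>L C a \<and> C a o\<^sub>L W = W o\<^sub>L C a" for a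
    by (rule comm; rule blinfun_eqI) (simp_all add: C A_cscale A'_cscale mult.commute)
  have comm_Q: "Q o\<^sub>L V = V o\<^sub>L Q \<and> Q o\<^sub>L W = W o\<^sub>L Q"
    by (rule comm; rule blinfun_eqI) (auto simp: C Q A_restrict A'_restrict intro!: l2_eqI)
  show thesis
  proof
    show "norm (V x) = norm x" "surj V" "norm (W x) = norm x" "surj W" for x by fact+
    show "V (cscale a x) = cscale a (V x)" "W (cscale a x) = cscale a (W x)" for a x
      using comm_C[of a] by (metis C blinfun_apply_blinfun_compose)+
    show "V (l2_restrict S x) = l2_restrict S (V x)" "W (l2_restrict S x) = l2_restrict S (W x)" for x
      using comm_Q by (metis Q blinfun_apply_blinfun_compose)+
    have zero: "T (unit_seq k) = 0" if "\<And>x. norm (T x) \<le> 0 * norm x" for T :: "l2 \<Rightarrow>\<^sub>L l2" and k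
      using that[of "unit_seq k"] by simp
    show "Tp (unit_seq k) = (\<tau>p / (1 - \<epsilon>)) *\<^sub>R (V (unit_seq (s k)) + W (unit_seq (s k)) - unit_seq (s k))" for k
    proof (cases "\<tau>p = 0")
      case False
      have "l2_reindex s (unit_seq (s k)) = unit_seq k" "l2_reindex t (unit_seq (s k)) = 0"
        using \<open>inj s\<close> \<open>inj t\<close> by (auto intro!: l2_eqI simp: coord_l2_reindex st inj_eq)
      then show ?thesis using False \<open>\<epsilon> < 1\<close>
        by (simp add: VW(5) A Ap_def Am_def blinfun.bilinear_simps)
    qed (use zero Tp(3) in auto)
    show "Tm (unit_seq k) = (\<tau>m / (1 - \<epsilon>)) *\<^sub>R (V (unit_seq (t k)) + W (unit_seq (t k)) - unit_seq (t k))" for k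
    proof (cases "\<tau>m = 0")
      case False
      have "l2_reindex t (unit_seq (t k)) = unit_seq k" "l2_reindex s (unit_seq (t k)) = 0"
        using \<open>inj s\<close> \<open>inj t\<close> by (auto intro!: l2_eqI simp: coord_l2_reindex st inj_eq)
      then show ?thesis using False \<open>\<epsilon> < 1\<close>
        by (simp add: VW(5) A Ap_def Am_def blinfun.bilinear_simps)
    qed (use zero Tm(3) in auto)
  qed
qed

section \<open>Coordinates of a Krein space with a J-orthonormal basis\<close>

lemma (in indefinite_inner_product_space) hilbert_subspace_complete:
  assumes "hilbert_subspace g S" "\<And>n. s n \<in> S"
    and "\<And>d. d > 0 \<Longrightarrow> \<exists>M. \<forall>m\<ge>M. \<forall>n\<ge>M. sqrt (Re (g (s m - s n) (s m - s n))) < d"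
  obtains x where "x \<in> S" "(\<lambda>n. sqrt (Re (g (s n - x) (s n - x)))) \<longlonglongrightarrow> 0"
proof -
  have "(\<forall>n. s n \<in> S) \<and> (\<forall>d>0. \<exists>M. \<forall>m\<ge>M. \<forall>n\<ge>M. sqrt (Re (g (s m - s n) (s m - s n))) < d)
      \<longrightarrow> (\<exists>x\<in>S. (\<lambda>n. sqrt (Re (g (s n - x) (s n - x)))) \<longlonglongrightarrow> 0)"
    using assms(1) unfolding hilbert_subspace_def by (elim conjE allE[of _ s])
  then show thesis using assms(2,3) that by auto
qed

section \<open>The positive definite inner product of a fundamental decomposition\<close>

context krein_space
begin

lemma hilbert_Kp: "hilbert_subspace ip Kp" and hilbert_Km: "hilbert_subspace (\<lambda>x y. - ip x y) Km"
  using decomposition by (simp_all add: fundamental_decomposition_def)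

lemma subspace_Kp: "subspace Kp" and subspace_Km: "subspace Km"
  using decomposition by (auto simp: fundamental_decomposition_def hilbert_subspace_def)

lemma ip_Kp_pos: "x \<in> Kp \<Longrightarrow> x \<noteq> 0 \<Longrightarrow> 0 < Re (ip x x)"
  and ip_Km_neg: "x \<in> Km \<Longrightarrow> x \<noteq> 0 \<Longrightarrow> Re (ip x x) < 0"
  and ip_Kp_Km: "x \<in> Kp \<Longrightarrow> y \<in> Km \<Longrightarrow> ip x y = 0"
  using decomposition by (auto simp: fundamental_decomposition_def hilbert_subspace_def)

lemma ip_Km_Kp: "x \<in> Km \<Longrightarrow> y \<in> Kp \<Longrightarrow> ip x y = 0"
  using ip_Kp_Km[of y x] ip_commute[of x y] by simp

lemma ip_add_right: "ip x (y + z) = ip x y + ip x z"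
  by (metis ip_add_left ip_commute complex_cnj_add)

lemma ip_scale_right: "ip x (scale a y) = cnj a * ip x y"
  by (metis ip_scale_left ip_commute complex_cnj_mult)

lemma ip_zero_left [simp]: "ip 0 y = 0"
  using ip_scale_left[of 0 0 y] by simp

lemma ip_zero_right [simp]: "ip x 0 = 0"
  using ip_scale_right[of x 0 0] by simp

lemma pos_part_unique: "p \<in> Kp \<Longrightarrow> x - p \<in> Km \<Longrightarrow> pos_part x = p"
  and pos_part_in: "pos_part x \<in> Kp" and neg_part_in: "neg_part x \<in> Km"
proof -
  have ex1: "\<exists>!p. p \<in> Kp \<and> x - p \<in> Km"
    using decomposition by (auto simp: fundamental_decomposition_def)
  from theI'[OF this] show "pos_part x \<in> Kp" "neg_part x \<in> Km"
    by (simp_all add: pos_part_def neg_part_def)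
  show "pos_part x = p" if "p \<in> Kp" "x - p \<in> Km"
    unfolding pos_part_def by (rule the1_equality[OF ex1]) (use that in blast)
qed

lemma pos_neg_part: "pos_part x + neg_part x = x"
  by (simp add: neg_part_def)

lemma pos_part_add: "pos_part (x + y) = pos_part x + pos_part y"
  and pos_part_scale: "pos_part (scale a x) = scale a (pos_part x)"
proof -
  have "x + y - (pos_part x + pos_part y) = neg_part x + neg_part y" by (simp add: neg_part_def)
  then show "pos_part (x + y) = pos_part x + pos_part y"
    by (intro pos_part_unique)
      (simp_all add: subspace_add subspace_Kp subspace_Km pos_part_in neg_part_in)
  have "scale a x - scale a (pos_part x) = scale a (neg_part x)"
    by (simp add: neg_part_def scale_right_diff_distrib)
  then show "pos_part (scale a x) = scale a (pos_part x)"
    by (intro pos_part_unique)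
      (simp_all add: subspace_scale subspace_Kp subspace_Km pos_part_in neg_part_in)
qed

lemma neg_part_add: "neg_part (x + y) = neg_part x + neg_part y"
  and neg_part_scale: "neg_part (scale a x) = scale a (neg_part x)"
  by (simp_all add: neg_part_def pos_part_add pos_part_scale scale_right_diff_distrib)

lemma parts_Kp: "x \<in> Kp \<Longrightarrow> pos_part x = x" "x \<in> Kp \<Longrightarrow> neg_part x = 0"
  using pos_part_unique[of x x] by (simp_all add: neg_part_def subspace_0 subspace_Km)

lemma parts_Km: "x \<in> Km \<Longrightarrow> pos_part x = 0" "x \<in> Km \<Longrightarrow> neg_part x = x"
  using pos_part_unique[of 0 x] by (simp_all add: neg_part_def subspace_0 subspace_Kp)

text \<open>This is \<open>ip (J x) y\<close> for the fundamental symmetry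
  \<open>J x = pos_part x - neg_part x\<close>, the inner product whose norm is
  \<open>jnorm\<close>.\<close>

definition jip :: "'a \<Rightarrow> 'a \<Rightarrow> complex" where
  "jip x y = ip (pos_part x) (pos_part y) - ip (neg_part x) (neg_part y)"

lemma jip_add_left: "jip (x + y) z = jip x z + jip y z"
  and jip_add_right: "jip x (y + z) = jip x y + jip x z"
  and jip_scale_left: "jip (scale a x) y = a * jip x y"
  and jip_scale_right: "jip x (scale a y) = cnj a * jip x y"
  by (simp_all add: jip_def pos_part_add neg_part_add pos_part_scale neg_part_scale ip_add_left
      ip_add_right ip_scale_left ip_scale_right algebra_simps)

lemma jip_commute: "jip x y = cnj (jip y x)"
  unfolding jip_def by (metis ip_commute complex_cnj_diff)

lemma jip_diff_left: "jip (x - y) z = jip x z - jip y z"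
  using jip_add_left[of "x - y" y z] by simp

lemma jip_diff_right: "jip x (y - z) = jip x y - jip x z"
  using jip_add_right[of x "y - z" z] by simp

lemma jip_sum_left: "jip (\<Sum>i\<in>I. f i) y = (\<Sum>i\<in>I. jip (f i) y)"
proof (induction I rule: infinite_finite_induct)
  case (insert i I)
  then show ?case by (simp add: jip_add_left)
qed (use jip_diff_left[of 0 0 y] in simp_all)

text \<open>One argument in \<open>Kp\<close> is enough: orthogonality to \<open>Km\<close> discards
  the negative part of the other.\<close>

lemma jip_Kp: "x \<in> Kp \<Longrightarrow> jip x y = ip x y" "y \<in> Kp \<Longrightarrow> jip x y = ip x y"
  using ip_add_right[of x "pos_part y" "neg_part y"] ip_add_left[of "pos_part x" "neg_part x" y]
  by (simp_all add: jip_def parts_Kp pos_neg_part ip_Kp_Km ip_Km_Kp neg_part_in)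

lemma jip_Km: "x \<in> Km \<Longrightarrow> jip x y = - ip x y" "y \<in> Km \<Longrightarrow> jip x y = - ip x y"
  using ip_add_right[of x "pos_part y" "neg_part y"] ip_add_left[of "pos_part x" "neg_part x" y]
  by (simp_all add: jip_def parts_Km pos_neg_part ip_Kp_Km ip_Km_Kp pos_part_in)

lemma jnorm_eq: "jnorm x = sqrt (Re (jip x x))"
  by (simp add: jnorm_def jip_def)

lemma jip_pos: "x \<noteq> 0 \<Longrightarrow> 0 < Re (jip x x)"
proof -
  assume "x \<noteq> 0"
  have "0 \<le> Re (ip (pos_part x) (pos_part x))" "Re (ip (neg_part x) (neg_part x)) \<le> 0"
    using ip_Kp_pos[OF pos_part_in, of x] ip_Km_neg[OF neg_part_in, of x]
    by (cases "pos_part x = 0"; cases "neg_part x = 0"; force)+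
  moreover have "pos_part x \<noteq> 0 \<or> neg_part x \<noteq> 0" using pos_neg_part[of x] \<open>x \<noteq> 0\<close> by auto
  ultimately show ?thesis
    using ip_Kp_pos[OF pos_part_in, of x] ip_Km_neg[OF neg_part_in, of x] by (auto simp: jip_def)
qed

lemma jip_zero [simp]: "jip 0 x = 0"
  using jip_diff_left[of 0 0 x] by simp

lemma jip_self_nonneg: "0 \<le> Re (jip x x)"
  by (cases "x = 0") (simp, rule less_imp_le, erule jip_pos)

lemma jnorm_sq: "(jnorm x)\<^sup>2 = Re (jip x x)"
  by (simp add: jnorm_eq jip_self_nonneg)

lemma jnorm_nonneg: "0 \<le> jnorm x"
  by (simp add: jnorm_eq jip_self_nonneg)

lemma jnorm_eq_0: "jnorm x = 0 \<Longrightarrow> x = 0"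
  using jip_pos[of x] by (auto simp flip: jnorm_sq)

lemma subset_closed_span: "x \<in> S \<Longrightarrow> x \<in> closed_span S"
  unfolding closed_span_def jconverges_def
  by (auto intro!: exI[of _ "\<lambda>_. x"] span_base simp: jnorm_eq)

lemma closed_span_minimal:
  assumes "subspace L" "S \<subseteq> L" "\<And>s x. (\<And>n. s n \<in> L) \<Longrightarrow> jconverges s x \<Longrightarrow> x \<in> L"
  shows "closed_span S \<subseteq> L"
  using assms(3) span_minimal[OF assms(2,1)] unfolding closed_span_def by blast

end

section \<open>The coordinate isometry onto \<open>l2\<close>\<close>

context krein_space_with_basis
begin

definition coef :: "'a \<Rightarrow> nat \<Rightarrow> complex" where
  "coef x j = jip x (e j)"

abbreviation "pos \<equiv> pos_indices e"

lemma e_Kp: "j \<in> pos \<Longrightarrow> e j \<in> Kp"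
  by (rule Kp_eq[THEN equalityD2, THEN subsetD]) (simp add: K_plus_def subset_closed_span)

lemma neg_indices_eq: "neg_indices e = - pos"
  using basis by (auto simp: J_orthonormal_basis_def J_orthonormal_def pos_indices_def neg_indices_def)

lemma e_Km: "j \<notin> pos \<Longrightarrow> e j \<in> Km"
  by (rule Km_eq[THEN equalityD2, THEN subsetD])
    (simp add: K_minus_def neg_indices_eq subset_closed_span)

lemma jip_e: "jip (e i) (e j) = (if i = j then 1 else 0)"
proof -
  have "i \<noteq> j \<Longrightarrow> ip (e i) (e j) = 0" "ip (e j) (e j) = (if j \<in> pos then 1 else -1)"
    using basis by (auto simp: J_orthonormal_basis_def J_orthonormal_def pos_indices_def)
  then show ?thesis using e_Kp[of j] e_Km[of j] by (cases "j \<in> pos") (auto simp: jip_Kp jip_Km)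
qed

lemma coef_add: "coef (x + y) j = coef x j + coef y j"
  and coef_diff: "coef (x - y) j = coef x j - coef y j"
  and coef_scale: "coef (scale a x) j = a * coef x j"
  by (simp_all add: coef_def jip_add_left jip_diff_left jip_scale_left)

lemma coef_partial_sum: "coef (\<Sum>i<n. scale (c i) (e i)) j = (if j < n then c j else 0)"
  by (simp add: coef_def jip_sum_left jip_scale_left jip_e if_distrib[of "(*) _"] sum.If_cases cong: if_cong)

lemma jip_sum_e: "jip x (\<Sum>i<n. scale (c i) (e i)) = (\<Sum>i<n. coef x i * cnj (c i))"
proof -
  have "jip (e i) x = cnj (coef x i)" for i unfolding coef_def by (rule jip_commute)
  then show ?thesis by (subst jip_commute) (simp add: jip_sum_left jip_scale_left mult.commute)
qed

lemma jnorm_diff_partial_sum: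
  "(jnorm (x - (\<Sum>i<n. scale (coef x i) (e i))))\<^sup>2 = (jnorm x)\<^sup>2 - (\<Sum>i<n. (cmod (coef x i))\<^sup>2)"
proof -
  let ?s = "\<Sum>i<n. scale (coef x i) (e i)"
  have "jip x ?s = of_real (\<Sum>i<n. (cmod (coef x i))\<^sup>2)"
    by (simp add: jip_sum_e complex_norm_square del: of_real_power)
  moreover have "jip ?s ?s = of_real (\<Sum>i<n. (cmod (coef x i))\<^sup>2)"
    by (simp add: jip_sum_e coef_partial_sum complex_norm_square del: of_real_power)
  moreover have "jip ?s x = cnj (jip x ?s)" by (rule jip_commute)
  ultimately show ?thesis
    by (simp add: jnorm_sq jip_diff_left jip_diff_right)
qed

text \<open>The one-term Bessel inequality, from the squared distance of \<open>x\<close> to its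
  projection on \<open>e j\<close>; it makes each coefficient continuous for
  \<open>jnorm\<close>.\<close>

lemma cmod_coef_le: "cmod (coef x j) \<le> jnorm x"
proof -
  let ?z = "x - scale (coef x j) (e j)"
  have "jip x (scale (coef x j) (e j)) = of_real ((cmod (coef x j))\<^sup>2)"
    by (simp add: jip_scale_right coef_def[symmetric] complex_norm_square mult.commute del: of_real_power)
  moreover have "jip (scale (coef x j) (e j)) (scale (coef x j) (e j)) = of_real ((cmod (coef x j))\<^sup>2)"
    by (simp add: jip_scale_right jip_scale_left jip_e complex_norm_square mult.commute del: of_real_power)
  moreover have "jip (scale (coef x j) (e j)) x = cnj (jip x (scale (coef x j) (e j)))" by (rule jip_commute)
  ultimately have "(jnorm ?z)\<^sup>2 = (jnorm x)\<^sup>2 - (cmod (coef x j))\<^sup>2"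
    by (simp add: jnorm_sq jip_diff_left jip_diff_right del: of_real_power)
  then have "(cmod (coef x j))\<^sup>2 \<le> (jnorm x)\<^sup>2"
    using zero_le_power2[of "jnorm ?z"] by linarith
  then show ?thesis using jnorm_nonneg by (rule power2_le_imp_le)
qed

text \<open>The basis property supplies some coefficients \<open>c\<close>. Continuity of
  \<open>coef\<close> identifies them, since the coefficient number \<open>j\<close> of the partial
  sums is eventually \<open>c j\<close>.\<close>

lemma coef_expansion: "jconverges (\<lambda>n. \<Sum>j<n. scale (coef x j) (e j)) x"
proof -
  obtain c where c: "jconverges (\<lambda>n. \<Sum>j<n. scale (c j) (e j)) x"
    using basis unfolding J_orthonormal_basis_def by blast
  have "c j = coef x j" for j
  proof -
    have "(\<lambda>n. cmod (coef ((\<Sum>j<n. scale (c j) (e j)) - x) j)) \<longlonglongrightarrow> 0"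
      by (rule tendsto_sandwich[OF _ _ tendsto_const c[unfolded jconverges_def]])
        (simp_all add: cmod_coef_le)
    moreover have "(\<lambda>n. cmod (coef ((\<Sum>j<n. scale (c j) (e j)) - x) j)) \<longlonglongrightarrow> cmod (c j - coef x j)"
      unfolding coef_diff coef_partial_sum
      by (rule tendsto_eventually, rule eventually_mono[OF eventually_gt_at_top[of j]]) simp
    ultimately have "cmod (c j - coef x j) = 0" by (rule LIMSEQ_unique[symmetric])
    then show ?thesis by simp
  qed
  then show ?thesis using c by simp
qed

lemma jnorm_minus_commute: "jnorm (x - y) = jnorm (y - x)"
  by (simp add: jnorm_eq jip_diff_left jip_diff_right)

text \<open>Parseval's identity: the expansion converges, so the error computed in
  \<open>jnorm_diff_partial_sum\<close> tends to 0.\<close>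

lemma coef_sums: "(\<lambda>j. (cmod (coef x j))\<^sup>2) sums (jnorm x)\<^sup>2"
proof -
  have "(\<lambda>n. (jnorm (x - (\<Sum>j<n. scale (coef x j) (e j))))\<^sup>2) \<longlonglongrightarrow> 0\<^sup>2"
    using coef_expansion[of x] unfolding jconverges_def jnorm_minus_commute[of _ x]
    by (rule tendsto_power)
  then have "(\<lambda>n. (jnorm x)\<^sup>2 - ((jnorm x)\<^sup>2 - (\<Sum>i<n. (cmod (coef x i))\<^sup>2))) \<longlonglongrightarrow> (jnorm x)\<^sup>2 - 0\<^sup>2"
    unfolding jnorm_diff_partial_sum by (intro tendsto_diff tendsto_const)
  then show ?thesis by (simp add: sums_def)
qed

definition to_l2 :: "'a \<Rightarrow> l2" where
  "to_l2 x = l2_of (coef x)"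

lemma coord_to_l2 [simp]: "coord (to_l2 x) j = coef x j"
  using coef_sums[of x] by (simp add: to_l2_def coord_l2_of sums_iff)

lemma norm_to_l2: "norm (to_l2 x) = jnorm x"
proof -
  have "(norm (to_l2 x))\<^sup>2 = (jnorm x)\<^sup>2"
    using coef_sums[of x] by (simp add: norm_l2_sq sums_iff)
  then show ?thesis by (simp add: jnorm_nonneg power2_eq_iff_nonneg)
qed

lemma to_l2_add: "to_l2 (x + y) = to_l2 x + to_l2 y"
  and to_l2_diff: "to_l2 (x - y) = to_l2 x - to_l2 y"
  and to_l2_scale: "to_l2 (scale a x) = cscale a (to_l2 x)"
  by (auto intro!: l2_eqI simp: coef_add coef_diff coef_scale)

lemma to_l2_zero: "to_l2 0 = 0"
  using to_l2_diff[of 0 0] by simp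

lemma to_l2_sum: "to_l2 (\<Sum>i\<in>I. f i) = (\<Sum>i\<in>I. to_l2 (f i))"
  by (induction I rule: infinite_finite_induct) (simp_all add: to_l2_zero to_l2_add)

lemma inj_to_l2: "inj to_l2"
proof (rule injI)
  fix x y assume "to_l2 x = to_l2 y"
  then have "norm (to_l2 (x - y)) = 0" by (simp add: to_l2_diff)
  then have "jnorm (x - y) = 0" by (simp only: norm_to_l2)
  then show "x = y" using jnorm_eq_0[of "x - y"] by simp
qed

lemma to_l2_e: "to_l2 (e j) = unit_seq j"
  by (rule l2_eqI) (simp add: coef_def jip_e)

lemma jconverges_iff: "jconverges s x \<longleftrightarrow> (\<lambda>n. to_l2 (s n)) \<longlonglongrightarrow> to_l2 x"
  unfolding jconverges_def norm_to_l2[symmetric] to_l2_diff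
  by (simp add: tendsto_norm_zero_iff LIM_zero_iff)

lemma inner_to_l2: "inner (to_l2 x) (to_l2 y) = Re (jip x y)"
proof -
  have "2 * inner (to_l2 x) (to_l2 y) = (jnorm (x + y))\<^sup>2 - (jnorm x)\<^sup>2 - (jnorm y)\<^sup>2"
    unfolding norm_to_l2[symmetric] to_l2_add
    by (simp add: power2_norm_eq_inner inner_add inner_commute)
  also have "\<dots> = 2 * Re (jip x y)"
    using jip_commute[of y x] by (simp add: jnorm_sq jip_add_left jip_add_right)
  finally show ?thesis by simp
qed

lemma cinner_to_l2: "cinner (to_l2 x) (to_l2 y) = jip x y"
  unfolding cinner_def to_l2_scale[symmetric] inner_to_l2 jip_scale_right
  by (simp add: complex_eq_iff)

text \<open>Completeness is assumed on the two halves of the decomposition only, so limits of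
  coordinate vectors are pulled back separately for \<open>Kp\<close> and \<open>Km\<close>.\<close>

lemma to_l2_Kp_complete:
  assumes "\<And>n. s n \<in> Kp" "(\<lambda>n. to_l2 (s n)) \<longlonglongrightarrow> y"
  obtains x where "x \<in> Kp" "to_l2 x = y"
proof -
  have jnorm_Kp: "sqrt (Re (ip x x)) = norm (to_l2 x)" if "x \<in> Kp" for x
    using that by (simp add: norm_to_l2 jnorm_eq jip_Kp)
  have diff: "s m - s n \<in> Kp" for m n using assms(1) subspace_Kp by (simp add: subspace_diff)
  have cauchy: "\<exists>M. \<forall>m\<ge>M. \<forall>n\<ge>M. sqrt (Re (ip (s m - s n) (s m - s n))) < d" if "d > 0" for d
    using metric_CauchyD[OF LIMSEQ_imp_Cauchy[OF assms(2)] that]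
    by (simp add: jnorm_Kp diff to_l2_diff dist_norm)
  obtain x where x: "x \<in> Kp" "(\<lambda>n. sqrt (Re (ip (s n - x) (s n - x)))) \<longlonglongrightarrow> 0"
    by (rule hilbert_subspace_complete[OF hilbert_Kp assms(1) cauchy]) assumption
  have "s n - x \<in> Kp" for n using assms(1) x(1) subspace_Kp by (simp add: subspace_diff)
  then have "(\<lambda>n. to_l2 (s n)) \<longlonglongrightarrow> to_l2 x"
    using x(2) by (simp add: jnorm_Kp to_l2_diff tendsto_norm_zero_iff LIM_zero_iff)
  then show thesis using that[OF x(1)] LIMSEQ_unique[OF assms(2)] by blast
qed

lemma to_l2_Km_complete:
  assumes "\<And>n. s n \<in> Km" "(\<lambda>n. to_l2 (s n)) \<longlonglongrightarrow> y"
  obtains x where "x \<in> Km" "to_l2 x = y"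
proof -
  have jnorm_Km: "sqrt (Re (- ip x x)) = norm (to_l2 x)" if "x \<in> Km" for x
    using that by (simp add: norm_to_l2 jnorm_eq jip_Km)
  have diff: "s m - s n \<in> Km" for m n using assms(1) subspace_Km by (simp add: subspace_diff)
  have cauchy: "\<exists>M. \<forall>m\<ge>M. \<forall>n\<ge>M. sqrt (Re (- ip (s m - s n) (s m - s n))) < d" if "d > 0" for d
    using metric_CauchyD[OF LIMSEQ_imp_Cauchy[OF assms(2)] that]
    by (simp only: jnorm_Km diff to_l2_diff dist_norm)
  obtain x where x: "x \<in> Km" "(\<lambda>n. sqrt (Re (- ip (s n - x) (s n - x)))) \<longlonglongrightarrow> 0"
    by (rule hilbert_subspace_complete[OF hilbert_Km assms(1) cauchy]) assumption
  have "s n - x \<in> Km" for n using assms(1) x(1) subspace_Km by (simp add: subspace_diff)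
  then have "(\<lambda>n. norm (to_l2 (s n - x))) \<longlonglongrightarrow> 0"
    using x(2) by (simp only: jnorm_Km)
  then have "(\<lambda>n. to_l2 (s n)) \<longlonglongrightarrow> to_l2 x"
    by (simp add: to_l2_diff tendsto_norm_zero_iff LIM_zero_iff)
  then show thesis using that[OF x(1)] LIMSEQ_unique[OF assms(2)] by blast
qed

text \<open>Each \<open>e j\<close> lies entirely in \<open>Kp\<close> or in \<open>Km\<close>, so
  passing to the positive part keeps or kills its coefficient.\<close>

lemma to_l2_pos_part: "to_l2 (pos_part x) = l2_restrict pos (to_l2 x)"
proof (rule l2_eqI)
  fix j
  have "jip (pos_part x) (e j) = (if j \<in> pos then jip x (e j) else 0)"
    using e_Kp[of j] e_Km[of j]
    by (auto simp: jip_def parts_Kp parts_Km pos_part_in)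
  then show "coord (to_l2 (pos_part x)) j = coord (l2_restrict pos (to_l2 x)) j"
    by (simp add: coef_def)
qed

lemma to_l2_neg_part: "to_l2 (neg_part x) = to_l2 x - l2_restrict pos (to_l2 x)"
  by (simp add: neg_part_def to_l2_diff to_l2_pos_part)

lemma Kp_iff: "x \<in> Kp \<longleftrightarrow> l2_restrict pos (to_l2 x) = to_l2 x"
  unfolding to_l2_pos_part[symmetric] inj_eq[OF inj_to_l2]
  using pos_part_in[of x] parts_Kp(1)[of x] by metis

lemma Km_iff: "x \<in> Km \<longleftrightarrow> l2_restrict pos (to_l2 x) = 0"
  unfolding to_l2_pos_part[symmetric] to_l2_zero[symmetric] inj_eq[OF inj_to_l2]
  using neg_part_in[of x] parts_Km(1)[of x] by (auto simp: neg_part_def)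

text \<open>A vector \<open>y\<close> of \<open>l2\<close> is a limit of finite sums coming from
  \<open>K\<close>. Their positive and negative parts converge separately, to the two restrictions
  of \<open>y\<close>, and each half is complete.\<close>

lemma surj_to_l2: "surj to_l2"
proof -
  have sub: "l2_restrict pos y \<in> range to_l2" "y - l2_restrict pos y \<in> range to_l2" for y
  proof -
    let ?s = "\<lambda>n. \<Sum>j<n. scale (coord y j) (e j)"
    have s: "(\<lambda>n. to_l2 (?s n)) \<longlonglongrightarrow> y"
      using l2_expansion[of y] by (simp add: to_l2_sum to_l2_scale to_l2_e)
    have lim: "(\<lambda>n. l2_restrict pos (to_l2 (?s n))) \<longlonglongrightarrow> l2_restrict pos y"
      by (rule bounded_linear.tendsto[OF bounded_linear_l2_restrict s])
    have "(\<lambda>n. to_l2 (pos_part (?s n))) \<longlonglongrightarrow> l2_restrict pos y"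
      unfolding to_l2_pos_part by (rule lim)
    then obtain x where "to_l2 x = l2_restrict pos y"
      using to_l2_Kp_complete[of "\<lambda>n. pos_part (?s n)"] pos_part_in by blast
    then show "l2_restrict pos y \<in> range to_l2" by (metis rangeI)
    have "(\<lambda>n. to_l2 (neg_part (?s n))) \<longlonglongrightarrow> y - l2_restrict pos y"
      unfolding to_l2_neg_part by (intro tendsto_diff s lim)
    then obtain x where "to_l2 x = y - l2_restrict pos y"
      using to_l2_Km_complete[of "\<lambda>n. neg_part (?s n)"] neg_part_in by blast
    then show "y - l2_restrict pos y \<in> range to_l2" by (metis rangeI)
  qed
  have "y \<in> range to_l2" for y
  proof -
    obtain p n where "to_l2 p = l2_restrict pos y" "to_l2 n = y - l2_restrict pos y"
      using sub[of y] by (metis imageE)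
    then have "to_l2 (p + n) = y" by (simp add: to_l2_add)
    then show ?thesis by (metis rangeI)
  qed
  then show ?thesis by blast
qed

definition from_l2 :: "l2 \<Rightarrow> 'a" where
  "from_l2 = inv to_l2"

lemma to_from_l2 [simp]: "to_l2 (from_l2 y) = y"
  unfolding from_l2_def by (rule surj_f_inv_f[OF surj_to_l2])

lemma from_to_l2 [simp]: "from_l2 (to_l2 x) = x"
  unfolding from_l2_def by (rule inv_f_f[OF inj_to_l2])

end

section \<open>Bases from unitaries and the pre-frame operators\<close>

context krein_space_with_basis
begin

text \<open>A complex-linear isometry preserves \<open>jip\<close>, and commuting with the
  restriction to \<open>pos\<close> it respects \<open>Kp\<close> and \<open>Km\<close>; hence the
  signs are retained. The closed spans of the new vectors are \<open>Kp\<close> and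
  \<open>Km\<close> again, which settles the last conjunct of
  \<open>J_orthonormal_basis\<close>.\<close>

lemma unitary_image_basis:
  fixes U :: "l2 \<Rightarrow>\<^sub>L l2"
  assumes norm: "\<And>x. norm (U x) = norm x" and "surj U"
    and cscale: "\<And>a x. U (cscale a x) = cscale a (U x)"
    and restrict: "\<And>x. U (l2_restrict pos x) = l2_restrict pos (U x)"
  defines "u \<equiv> \<lambda>j. from_l2 (U (unit_seq j))"
  shows "J_orthonormal_basis u" "pos_indices u = pos" "neg_indices u = - pos"
proof -
  have to_u: "to_l2 (u j) = U (unit_seq j)" for j by (simp add: u_def)
  have inner_U: "inner (U x) (U y) = inner x y" for x y
  proof -
    have "2 * inner (U x) (U y) = (norm (U (x + y)))\<^sup>2 - (norm (U x))\<^sup>2 - (norm (U y))\<^sup>2"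
      by (simp only: blinfun.add_right power2_norm_eq_inner inner_add inner_commute[of "U y" "U x"])
    also have "\<dots> = 2 * inner x y"
      by (simp only: norm power2_norm_eq_inner inner_add inner_commute[of y x])
    finally show ?thesis by simp
  qed
  have jip_u: "jip (u i) (u j) = (if i = j then 1 else 0)" for i j
  proof -
    have "jip (u i) (u j) = cinner (unit_seq i) (unit_seq j)"
      by (simp add: to_u cinner_def inner_U flip: cinner_to_l2 cscale)
    also have "\<dots> = jip (e i) (e j)" by (simp add: to_l2_e flip: cinner_to_l2)
    finally show ?thesis by (simp add: jip_e)
  qed
  have u_Kp: "u j \<in> Kp" if "j \<in> pos" for j
  proof -
    have "l2_restrict pos (unit_seq j) = unit_seq j" using that by (intro l2_eqI) auto
    then show ?thesis by (simp add: Kp_iff to_u flip: restrict)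
  qed
  have u_Km: "u j \<in> Km" if "j \<notin> pos" for j
  proof -
    have "l2_restrict pos (unit_seq j) = 0" using that by (intro l2_eqI) auto
    then show ?thesis by (simp add: Km_iff to_u flip: restrict)
  qed
  have ip_u: "ip (u i) (u j) = (if i = j then if j \<in> pos then 1 else -1 else 0)" for i j
  proof (cases "j \<in> pos")
    case True
    then show ?thesis using jip_u[of i j] by (simp add: jip_Kp u_Kp)
  next
    case False
    then have "ip (u i) (u j) = - jip (u i) (u j)" by (simp add: jip_Km u_Km)
    then show ?thesis using False by (simp add: jip_u)
  qed
  show pos_u: "pos_indices u = pos"
    unfolding pos_indices_def[of u] ip_u by (auto simp: complex_eq_iff)
  show neg_u: "neg_indices u = - pos"
    unfolding neg_indices_def[of u] ip_u by (auto simp: complex_eq_iff)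
  \<comment> \<open>Every vector has the form \<open>from_l2 (U y)\<close>, so expansions in
    \<open>u\<close> are those in \<open>unit_seq\<close> carried over by the isometry, with the
    same unique coefficients.\<close>
  have conv: "jconverges (\<lambda>n. \<Sum>j<n. scale (c j) (u j)) (from_l2 (U y)) \<longleftrightarrow> c = coord y" for c y
  proof -
    have "jconverges (\<lambda>n. \<Sum>j<n. scale (c j) (u j)) (from_l2 (U y)) \<longleftrightarrow>
        (\<lambda>n. U (\<Sum>j<n. cscale (c j) (unit_seq j))) \<longlonglongrightarrow> U y"
      by (simp add: jconverges_iff to_l2_sum to_l2_scale to_u cscale blinfun.sum_right)
    also have "\<dots> \<longleftrightarrow> (\<lambda>n. norm (U ((\<Sum>j<n. cscale (c j) (unit_seq j)) - y))) \<longlonglongrightarrow> 0"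
      by (simp only: blinfun.diff_right tendsto_norm_zero_iff LIM_zero_iff)
    also have "\<dots> \<longleftrightarrow> (\<lambda>n. \<Sum>j<n. cscale (c j) (unit_seq j)) \<longlonglongrightarrow> y"
      by (simp only: norm tendsto_norm_zero_iff LIM_zero_iff)
    also have "\<dots> \<longleftrightarrow> c = coord y"
      using l2_expansion_unique l2_expansion by auto
    finally show ?thesis .
  qed
  have preimage: "\<exists>y. x = from_l2 (U y)" for x
  proof -
    obtain y where "U y = to_l2 x" using \<open>surj U\<close> by (metis surjD)
    then have "x = from_l2 (U y)" by simp
    then show ?thesis ..
  qed
  have restrict_lim: "(\<lambda>n. l2_restrict pos (to_l2 (s n))) \<longlonglongrightarrow> l2_restrict pos (to_l2 x)"
    if "jconverges s x" for s x
    using that unfolding jconverges_iff by (rule bounded_linear.tendsto[OF bounded_linear_l2_restrict])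
  have U_inj: "x = y" if "U x = U y" for x y
    using norm[of "x - y"] that by (simp add: blinfun.diff_right)
  have in_closed_span: "from_l2 (U y) \<in> closed_span (u ` I)" if "\<And>j. j \<notin> I \<Longrightarrow> coord y j = 0" for y I
  proof -
    have "(\<Sum>j<n. scale (coord y j) (u j)) \<in> span (u ` I)" for n
      by (rule span_sum) (metis imageI span_base span_scale span_zero scale_zero_left that)
    then show ?thesis
      unfolding closed_span_def using conv[of "coord y" y]
      by (intro CollectI exI[of _ "\<lambda>n. \<Sum>j<n. scale (coord y j) (u j)"]) simp
  qed
  have Kp_u: "K_plus u = Kp"
  proof
    show "K_plus u \<subseteq> Kp"
      unfolding K_plus_def pos_u
    proof (rule closed_span_minimal[OF subspace_Kp])
      fix s x assume s: "\<And>n. s n \<in> Kp" "jconverges s x"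
      have "(\<lambda>n. to_l2 (s n)) \<longlonglongrightarrow> l2_restrict pos (to_l2 x)"
        using restrict_lim[OF s(2)] s(1) by (simp add: Kp_iff)
      then show "x \<in> Kp"
        using s(2) LIMSEQ_unique unfolding jconverges_iff Kp_iff by blast
    qed (auto simp: u_Kp)
    show "Kp \<subseteq> K_plus u"
    proof
      fix x assume "x \<in> Kp"
      obtain y where y: "x = from_l2 (U y)" using preimage by blast
      \<comment> \<open>Membership in \<open>Kp\<close> concerns the coordinates of
        \<open>U y\<close>; injectivity moves it to those of \<open>y\<close>, which are the
        coefficients of \<open>x\<close> with respect to \<open>u\<close>.\<close>
      have "U (l2_restrict pos y) = U y" using \<open>x \<in> Kp\<close> by (simp add: Kp_iff y restrict)
      then have "l2_restrict pos y = y" by (rule U_inj)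
      then have "coord y j = 0" if "j \<notin> pos" for j
        using that coord_l2_restrict[of pos y j] by simp
      then show "x \<in> K_plus u"
        unfolding K_plus_def pos_u y by (rule in_closed_span)
    qed
  qed
  have Km_u: "K_minus u = Km"
  proof
    show "K_minus u \<subseteq> Km"
      unfolding K_minus_def neg_u
    proof (rule closed_span_minimal[OF subspace_Km])
      fix s x assume s: "\<And>n. s n \<in> Km" "jconverges s x"
      have "(\<lambda>n. 0) \<longlonglongrightarrow> l2_restrict pos (to_l2 x)"
        using restrict_lim[OF s(2)] s(1) by (simp add: Km_iff)
      then show "x \<in> Km"
        unfolding Km_iff by (simp add: LIMSEQ_const_iff)
    qed (auto simp: u_Km)
    show "Km \<subseteq> K_minus u"
    proof
      fix x assume "x \<in> Km"
      obtain y where y: "x = from_l2 (U y)" using preimage by blast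
      have "U (l2_restrict pos y) = U 0"
        using \<open>x \<in> Km\<close> by (simp add: Km_iff y restrict blinfun.zero_right)
      then have "l2_restrict pos y = 0" by (rule U_inj)
      then have "coord y j = 0" if "j \<notin> - pos" for j
        using that coord_l2_restrict[of pos y j] by simp
      then show "x \<in> K_minus u"
        unfolding K_minus_def neg_u y by (rule in_closed_span)
    qed
  qed
  have "J_orthonormal u" by (simp add: J_orthonormal_def ip_u)
  moreover have "\<exists>!c. jconverges (\<lambda>n. \<Sum>j<n. scale (c j) (u j)) x" for x
    using preimage[of x] conv by metis
  ultimately show "J_orthonormal_basis u"
    using decomposition unfolding J_orthonormal_basis_def Kp_u Km_u by blast
qed

text \<open>The pre-frame operators act on raw sequences through \<open>THE\<close>, and their norm
  is a \<open>SUP\<close>; both have to be given their meaning. The limits exist and are unique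
  because \<open>T\<close> is bounded, and \<open>coord\<close> matches the unit balls.\<close>

lemma norm_le_operator_jnorm:
  fixes T :: "l2 \<Rightarrow>\<^sub>L l2"
  assumes T: "\<And>k. T (unit_seq k) = to_l2 (g k)" "\<And>a x. T (cscale a x) = cscale a (T x)"
  shows "norm (T x) \<le>
    operator_jnorm (\<lambda>c. THE y. jconverges (\<lambda>n. \<Sum>k<n. scale (c k) (g k)) y) * norm x"
proof -
  let ?T = "\<lambda>c. THE y. jconverges (\<lambda>n. \<Sum>k<n. scale (c k) (g k)) y"
  have lim: "(\<lambda>n. to_l2 (\<Sum>k<n. scale (coord x k) (g k))) \<longlonglongrightarrow> T x" for x
  proof -
    have "to_l2 (\<Sum>k<n. scale (coord x k) (g k)) = T (\<Sum>k<n. cscale (coord x k) (unit_seq k))" for n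
      by (simp add: to_l2_sum to_l2_scale T blinfun.sum_right)
    then show ?thesis
      using blinfun.tendsto[OF tendsto_const l2_expansion[of x]] by simp
  qed
  have T_eq: "to_l2 (?T (coord x)) = T x" for x
  proof -
    have "jconverges (\<lambda>n. \<Sum>k<n. scale (coord x k) (g k)) y \<longleftrightarrow> y = from_l2 (T x)" for y
      unfolding jconverges_iff using lim[of x] LIMSEQ_unique[OF lim[of x]]
      by (metis from_to_l2 to_from_l2)
    then show ?thesis by simp
  qed
  have ball: "{c \<in> ell2. ell2_norm c \<le> 1} = coord ` {x. norm x \<le> 1}"
  proof -
    have "ell2_norm (coord x) = norm x" "coord x \<in> ell2" for x
      by (simp_all add: ell2_norm_def ell2_def summable_coord flip: norm_l2_sq)
    moreover have "c = coord (l2_of c)" if "c \<in> ell2" for c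
      using that by (simp add: ell2_def coord_l2_of)
    ultimately show ?thesis by (auto simp: image_iff) metis
  qed
  have norm_T: "operator_jnorm ?T = (SUP x \<in> {x. norm x \<le> 1}. norm (T x))"
    unfolding operator_jnorm_def ball by (simp add: image_image T_eq flip: norm_to_l2)
  \<comment> \<open>A real supremum is known to be an upper bound only for a set that is bounded
    above.\<close>
  have bdd: "bdd_above ((\<lambda>x. norm (T x)) ` {x. norm x \<le> 1})"
  proof (rule bdd_aboveI2)
    fix x :: l2 assume "x \<in> {x. norm x \<le> 1}"
    then show "norm (T x) \<le> norm T"
      using order_trans[OF norm_blinfun mult_left_le[of "norm x" "norm T"]] by simp
  qed
  show ?thesis
  proof (cases "x = 0")
    case False
    have "norm (T (x /\<^sub>R norm x)) \<le> operator_jnorm ?T"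
      unfolding norm_T by (rule cSUP_upper[OF _ bdd]) (simp add: False)
    then show ?thesis using False by (simp add: blinfun.scaleR_right field_simps)
  qed (simp add: blinfun.zero_right)
qed

text \<open>Pairing with \<open>pos_part (f k)\<close> sees only the positive part of a vector, so
  the upper frame bound on \<open>Kp\<close> becomes a Bessel bound on all of
  \<open>l2\<close>.\<close>

lemma pos_synthesis_operator:
  assumes "frame f"
  obtains T :: "l2 \<Rightarrow>\<^sub>L l2" where
    "\<And>k. T (unit_seq k) = to_l2 (pos_part (f k))" "\<And>a x. T (cscale a x) = cscale a (T x)"
    "\<And>x. l2_restrict pos (T x) = T x" "\<And>x. norm (T x) \<le> operator_jnorm (T_plus f) * norm x"
proof -
  obtain B where "0 < B"
    and B: "\<And>x. x \<in> Kp \<Longrightarrow> summable (\<lambda>n. (cmod (ip x (pos_part (f n))))\<^sup>2)"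
      "\<And>x. x \<in> Kp \<Longrightarrow> (\<Sum>n. (cmod (ip x (pos_part (f n))))\<^sup>2) \<le> B * Re (ip x x)"
    using assms unfolding frame_def by (meson less_le_trans)
  have cinner: "cinner x (to_l2 (pos_part (f k))) = ip (pos_part (from_l2 x)) (pos_part (f k))" for x k
    using cinner_to_l2[of "from_l2 x" "pos_part (f k)"] by (simp add: jip_def parts_Kp pos_part_in)
  have norm_le: "B * Re (ip (pos_part (from_l2 x)) (pos_part (from_l2 x))) \<le> B * (norm x)\<^sup>2" for x
  proof -
    have "Re (ip (pos_part (from_l2 x)) (pos_part (from_l2 x))) = (norm (l2_restrict pos x))\<^sup>2"
      using jnorm_sq[of "pos_part (from_l2 x)"]
      by (simp add: jip_Kp pos_part_in to_l2_pos_part flip: norm_to_l2)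
    then show ?thesis using norm_l2_restrict_le[of pos x] \<open>0 < B\<close> by (simp add: power_mono)
  qed
  obtain T :: "l2 \<Rightarrow>\<^sub>L l2" where T: "\<And>k. T (unit_seq k) = to_l2 (pos_part (f k))"
      "\<And>a x. T (cscale a x) = cscale a (T x)"
    by (rule synthesis_operator_exists[of "\<lambda>k. to_l2 (pos_part (f k))" B])
      (auto simp: cinner intro: B pos_part_in order_trans[OF B(2) norm_le])
  have "l2_restrict pos (T x) = T x" for x
  proof (rule l2_operator_eqI[where F = "\<lambda>x. l2_restrict pos (T x)"])
    show "bounded_linear (\<lambda>x. l2_restrict pos (T x))"
      by (intro bounded_linear_compose[OF bounded_linear_l2_restrict] blinfun.bounded_linear_right)
    show "l2_restrict pos (T (cscale a (unit_seq k))) = T (cscale a (unit_seq k))" for a k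
      using Kp_iff[of "scale a (pos_part (f k))"]
      by (simp add: T to_l2_scale subspace_scale subspace_Kp pos_part_in)
  qed (rule blinfun.bounded_linear_right)
  moreover have "norm (T x) \<le> operator_jnorm (T_plus f) * norm x" for x
    unfolding T_plus_def[abs_def] by (rule norm_le_operator_jnorm) (simp_all add: T)
  ultimately show thesis using T that by blast
qed

text \<open>On \<open>Km\<close> both \<open>ip x x\<close> and the frame bound \<open>B\<close> are
  negative, so the Bessel constant is \<open>- B\<close>.\<close>

lemma neg_synthesis_operator:
  assumes "frame f"
  obtains T :: "l2 \<Rightarrow>\<^sub>L l2" where
    "\<And>k. T (unit_seq k) = to_l2 (neg_part (f k))" "\<And>a x. T (cscale a x) = cscale a (T x)"
    "\<And>x. l2_restrict pos (T x) = 0" "\<And>x. norm (T x) \<le> operator_jnorm (T_minus f) * norm x"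
proof -
  obtain B where "B < 0"
    and B: "\<And>x. x \<in> Km \<Longrightarrow> summable (\<lambda>n. (cmod (ip x (neg_part (f n))))\<^sup>2)"
      "\<And>x. x \<in> Km \<Longrightarrow> (\<Sum>n. (cmod (ip x (neg_part (f n))))\<^sup>2) \<le> B * Re (ip x x)"
    using assms unfolding frame_def by (meson le_less_trans)
  have cinner: "cinner x (to_l2 (neg_part (f k))) = - ip (neg_part (from_l2 x)) (neg_part (f k))" for x k
    using cinner_to_l2[of "from_l2 x" "neg_part (f k)"] by (simp add: jip_def parts_Km neg_part_in)
  have norm_le: "B * Re (ip (neg_part (from_l2 x)) (neg_part (from_l2 x))) \<le> - B * (norm x)\<^sup>2" for x
  proof -
    have "Re (ip (neg_part (from_l2 x)) (neg_part (from_l2 x))) = - (norm (l2_restrict (- pos) x))\<^sup>2"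
    proof -
      have "x - l2_restrict pos x = l2_restrict (- pos) x" by (rule l2_eqI) simp
      then show ?thesis
        using jnorm_sq[of "neg_part (from_l2 x)"]
        by (simp add: jip_Km neg_part_in to_l2_neg_part flip: norm_to_l2)
    qed
    then show ?thesis using norm_l2_restrict_le[of "- pos" x] \<open>B < 0\<close> by (simp add: power_mono)
  qed
  obtain T :: "l2 \<Rightarrow>\<^sub>L l2" where T: "\<And>k. T (unit_seq k) = to_l2 (neg_part (f k))"
      "\<And>a x. T (cscale a x) = cscale a (T x)"
    by (rule synthesis_operator_exists[of "\<lambda>k. to_l2 (neg_part (f k))" "- B"])
      (auto simp: cinner intro: B neg_part_in order_trans[OF B(2) norm_le, simplified])
  have "l2_restrict pos (T x) = 0" for x
  proof (rule l2_operator_eqI[where F = "\<lambda>x. l2_restrict pos (T x)" and G = "\<lambda>_. 0"])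
    show "bounded_linear (\<lambda>x. l2_restrict pos (T x))"
      by (intro bounded_linear_compose[OF bounded_linear_l2_restrict] blinfun.bounded_linear_right)
    show "l2_restrict pos (T (cscale a (unit_seq k))) = 0" for a k
      using Km_iff[of "scale a (neg_part (f k))"]
      by (simp add: T to_l2_scale subspace_scale subspace_Km neg_part_in)
  qed simp
  moreover have "norm (T x) \<le> operator_jnorm (T_minus f) * norm x" for x
    unfolding T_minus_def[abs_def] by (rule norm_le_operator_jnorm) (simp_all add: T)
  ultimately show thesis using T that by blast
qed

end

theorem theorem3p1:
  fixes scale :: "complex \<Rightarrow> 'a::ab_group_add \<Rightarrow> 'a"
    and ip :: "'a \<Rightarrow> 'a \<Rightarrow> complex"
    and Kp Km :: "'a set"
    and e f :: "nat \<Rightarrow> 'a"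
    and \<epsilon> :: real
  assumes "krein_space_with_basis scale ip Kp Km e"
    and "infinite (krein_space.pos_indices ip e)"
    and "infinite (krein_space.neg_indices ip e)"
    and "krein_space.frame ip Kp Km f"
    and "0 < \<epsilon>" and "\<epsilon> < 1"
  shows "\<exists>e1 e2 e3 :: nat \<Rightarrow> 'a.
     krein_space.J_orthonormal_basis scale ip Kp Km e1 \<and>
     krein_space.J_orthonormal_basis scale ip Kp Km e2 \<and>
     krein_space.J_orthonormal_basis scale ip Kp Km e3 \<and>
     (\<forall>k m. krein_space.pos_part Kp Km (f k) + krein_space.neg_part Kp Km (f m) =
        scale (complex_of_real (1 / (1 - \<epsilon>)))
         (scale (complex_of_real (krein_space.operator_jnorm ip Kp Km (krein_space.T_plus scale ip Kp Km f)))
            (krein_space.pos_member ip e1 k + krein_space.pos_member ip e2 k + krein_space.pos_member ip e3 k) +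
          scale (complex_of_real (krein_space.operator_jnorm ip Kp Km (krein_space.T_minus scale ip Kp Km f)))
            (krein_space.neg_member ip e1 m + krein_space.neg_member ip e2 m + krein_space.neg_member ip e3 m)))"
proof -
  interpret krein_space_with_basis scale ip Kp Km e by fact
  let ?\<tau>p = "operator_jnorm (T_plus f)" and ?\<tau>m = "operator_jnorm (T_minus f)"
  let ?s = "enumerate pos" and ?t = "enumerate (- pos)"
  \<comment> \<open>Both index sets being infinite, their enumerations are injective on all natural
    numbers, and \<open>pos_member\<close> and \<open>neg_member\<close> list actual
    members.\<close>
  have inf: "infinite pos" "infinite (- pos)" using assms(2,3) by (simp_all add: neg_indices_eq)
  have st: "inj ?s" "range ?s = pos" "inj ?t" "range ?t = - pos"
    using bij_enumerate[OF inf(1)] bij_enumerate[OF inf(2)] by (simp_all add: bij_betw_def)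
  obtain Tp :: "l2 \<Rightarrow>\<^sub>L l2" where Tp: "\<And>k. Tp (unit_seq k) = to_l2 (pos_part (f k))"
      "\<And>a x. Tp (cscale a x) = cscale a (Tp x)" "\<And>x. l2_restrict pos (Tp x) = Tp x"
      "\<And>x. norm (Tp x) \<le> ?\<tau>p * norm x"
    by (rule pos_synthesis_operator[OF assms(4)]) blast
  obtain Tm :: "l2 \<Rightarrow>\<^sub>L l2" where Tm: "\<And>k. Tm (unit_seq k) = to_l2 (neg_part (f k))"
      "\<And>a x. Tm (cscale a x) = cscale a (Tm x)" "\<And>x. l2_restrict pos (Tm x) = 0"
      "\<And>x. norm (Tm x) \<le> ?\<tau>m * norm x"
    by (rule neg_synthesis_operator[OF assms(4)]) blast
  obtain V W :: "l2 \<Rightarrow>\<^sub>L l2" where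
    V: "\<And>x. norm (V x) = norm x" "surj V" "\<And>a x. V (cscale a x) = cscale a (V x)"
      "\<And>x. V (l2_restrict pos x) = l2_restrict pos (V x)"
    and W: "\<And>x. norm (W x) = norm x" "surj W" "\<And>a x. W (cscale a x) = cscale a (W x)"
      "\<And>x. W (l2_restrict pos x) = l2_restrict pos (W x)"
    and Tp_eq: "\<And>k. Tp (unit_seq k) =
      (?\<tau>p / (1 - \<epsilon>)) *\<^sub>R (V (unit_seq (?s k)) + W (unit_seq (?s k)) - unit_seq (?s k))"
    and Tm_eq: "\<And>k. Tm (unit_seq k) =
      (?\<tau>m / (1 - \<epsilon>)) *\<^sub>R (V (unit_seq (?t k)) + W (unit_seq (?t k)) - unit_seq (?t k))"
    by (rule l2_pair_sum_unitaries[OF st(1) st(3) st(2) st(4) Tp(2-4) Tm(2-4) assms(5,6)]) blast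
  \<comment> \<open>This makes \<open>e3 j\<close> equal to \<open>- e j\<close>; as an operator it
    lets \<open>unitary_image_basis\<close> treat all three bases alike.\<close>
  define M :: "l2 \<Rightarrow>\<^sub>L l2" where "M = - id_blinfun"
  have M_apply: "M x = - x" for x by (simp add: M_def blinfun.minus_left)
  then have M: "norm (M x) = norm x" "surj M" "M (cscale a x) = cscale a (M x)"
      "M (l2_restrict pos x) = l2_restrict pos (M x)" for a x
    by (auto intro!: l2_eqI surjI[of _ uminus])
  define e1 where "e1 j = from_l2 (V (unit_seq j))" for j
  define e2 where "e2 j = from_l2 (W (unit_seq j))" for j
  define e3 where "e3 j = from_l2 (M (unit_seq j))" for j
  note bases = unitary_image_basis[OF V, folded e1_def] unitary_image_basis[OF W, folded e2_def]
    unitary_image_basis[OF M, folded e3_def]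
  have "pos_part (f k) + neg_part (f m) = scale (complex_of_real (1 / (1 - \<epsilon>)))
      (scale (complex_of_real ?\<tau>p) (pos_member e1 k + pos_member e2 k + pos_member e3 k) +
       scale (complex_of_real ?\<tau>m) (neg_member e1 m + neg_member e2 m + neg_member e3 m))" for k m
  proof (rule injD[OF inj_to_l2])
    have sum: "to_l2 (e1 j + e2 j + e3 j) = V (unit_seq j) + W (unit_seq j) - unit_seq j" for j
      by (simp add: to_l2_add e1_def e2_def e3_def M_apply)
    have lin: "to_l2 (scale (complex_of_real c) (scale (complex_of_real a) x + scale (complex_of_real b) y)) =
        (a * c) *\<^sub>R to_l2 x + (b * c) *\<^sub>R to_l2 y" for a b c x y
      by (simp add: to_l2_add to_l2_scale scaleR_add_right mult.commute)
    have "to_l2 (pos_part (f k) + neg_part (f m)) = Tp (unit_seq k) + Tm (unit_seq m)"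
      by (simp add: to_l2_add Tp(1) Tm(1))
    then show "to_l2 (pos_part (f k) + neg_part (f m)) = to_l2 (scale (complex_of_real (1 / (1 - \<epsilon>)))
      (scale (complex_of_real ?\<tau>p) (pos_member e1 k + pos_member e2 k + pos_member e3 k) +
       scale (complex_of_real ?\<tau>m) (neg_member e1 m + neg_member e2 m + neg_member e3 m)))"
      \<comment> \<open>By \<open>bases\<close> the three sequences share the index sets
        \<open>pos\<close> and \<open>- pos\<close>, so their positive members number
        \<open>k\<close> all sit at \<open>?s k\<close> and their negative members number
        \<open>m\<close> at \<open>?t m\<close>.\<close>
      unfolding pos_member_def neg_member_def bases lin sum Tp_eq Tm_eq by simp
  qed
  then show ?thesis using bases by blast
qed

end
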